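(* Consider the $M/GI/1/n$ queueing system described in the context. If $\varrho=1$ and $\varrho_2<\infty$, then $$\mathbf E P_{n+1}-\mathbf E P_n=\frac{2}{\varrho_2}+o(1),\qquad n\to\infty,$$ where $P_n$ (respectively $P_{n+1}$) is the number of processed messages during a busy period of the $M/GI/1/n$ (respectively $M/GI/1/(n+1)$) queueing system.
   Context: $M/GI/1/n$ system: messages arrive according to a Poisson process of rate $\lambda>0$ at a single server with $n$ waiting places (not counting the place in service); service times are i.i.d., independent of arrivals, with distribution function $B(x)$ and mean $b=\int_0^\infty x\,dB(x)\in(0,\infty)$. A message that finds at most $n$ messages in the system on arrival is accepted, otherwise it is refused (leaves without service). The arrival rate and service distribution are the same for all $n$. Let $\varrho_j=\lambda^j\int_0^\infty x^j\,dB(x)$ and $\varrho=\varrho_1=\lambda b$. (This is the case in which every message contains the same number $l$ of packets and the buffer holds $N$ packets, with $n=\lfloor N/l\rfloor$.) A busy period starts when a message arrives to the empty system and ends when the system next becomes empty. Processed messages are those served; in particular $\mathbf E P_0=1$. *)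

theory Defs
  imports "HOL-Probability.Probability" "HOL-Library.Landau_Symbols"
begin

text \<open>
  A single server with \<open>n\<close> waiting places, driven by a sequence \<open>T\<close> of arrival epochs and a
  sequence \<open>S\<close> of service times (both indexed from 0), empty before the first arrival.
  The message arriving at \<open>T i\<close> is accepted iff it finds at most \<open>n\<close> messages in the system.
  Service is in order of arrival, and \<open>S k\<close> is the service time of the \<open>k\<close>-th accepted message
  (a refused message receives no service).  A message that departs exactly at an arrival epoch is
  no longer seen by the arriving message.
\<close>

text \<open>
  \<open>departures n T S i\<close> lists, in order of acceptance, the departure epochs of those among the first
  \<open>i\<close> arrivals that are accepted.  The service of an accepted message begins as soon as it
  has arrived and its accepted predecessor has departed.
\<close>
fun departures :: "nat \<Rightarrow> (nat \<Rightarrow> real) \<Rightarrow> (nat \<Rightarrow> real) \<Rightarrow> nat \<Rightarrow> real list" where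
  "departures n T S 0 = []"
| "departures n T S (Suc i) =
     (let ds = departures n T S i in
      if length (filter (\<lambda>d. T i < d) ds) \<le> n
      then ds @ [(if ds = [] then T i else max (T i) (last ds)) + S (length ds)]
      else ds)"

definition accepted :: "nat \<Rightarrow> (nat \<Rightarrow> real) \<Rightarrow> (nat \<Rightarrow> real) \<Rightarrow> nat \<Rightarrow> bool" where
  "accepted n T S i \<longleftrightarrow> length (filter (\<lambda>d. T i < d) (departures n T S i)) \<le> n"

text \<open>Meaningful only if message \<open>i\<close> is accepted.\<close>
definition departure :: "nat \<Rightarrow> (nat \<Rightarrow> real) \<Rightarrow> (nat \<Rightarrow> real) \<Rightarrow> nat \<Rightarrow> real" where
  "departure n T S i = last (departures n T S (Suc i))"

definition in_system :: "nat \<Rightarrow> (nat \<Rightarrow> real) \<Rightarrow> (nat \<Rightarrow> real) \<Rightarrow> real \<Rightarrow> nat set" where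
  "in_system n T S t = {i. accepted n T S i \<and> T i \<le> t \<and> t < departure n T S i}"

text \<open>
  The first busy period begins at \<open>T 0\<close>, when message 0 arrives to the empty system; its end is
  \<open>\<infinity>\<close> if the system never becomes empty again.
\<close>
definition busy_period_end :: "nat \<Rightarrow> (nat \<Rightarrow> real) \<Rightarrow> (nat \<Rightarrow> real) \<Rightarrow> ereal" where
  "busy_period_end n T S = Inf (ereal ` {t. T 0 \<le> t \<and> in_system n T S t = {}})"

text \<open>
  The number of messages served during the first busy period, counted in \<open>ennreal\<close> so that an
  infinite number is not confused with zero.  (Later busy periods contribute nothing almost surely, since their
  messages depart after \<open>busy_period_end\<close>.)
\<close>
definition processed :: "nat \<Rightarrow> (nat \<Rightarrow> real) \<Rightarrow> (nat \<Rightarrow> real) \<Rightarrow> ennreal" where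
  "processed n T S = emeasure (count_space UNIV)
     {i. accepted n T S i \<and> ereal (departure n T S i) \<le> busy_period_end n T S}"

text \<open>
  The data of the M/GI/1/n systems, common to all \<open>n\<close>: the inter-arrival times \<open>A i\<close> of a Poisson
  process of rate \<open>lam\<close>, and i.i.d. service times \<open>S k\<close> independent of the arrivals.  The distribution
  function is represented by the distribution \<open>B\<close> on the real line that it determines, so that the
  integral with respect to \<open>dB(x)\<close> is the integral with respect to the measure \<open>B\<close>.
\<close>
locale MGI1 = prob_space M
  for M :: "'a measure"
    and A S :: "nat \<Rightarrow> 'a \<Rightarrow> real"
    and lam :: real
    and B :: "real measure" +
  assumes rate_pos: "0 < lam"
    and interarrival: "\<And>i. distributed M lborel (A i) (exponential_density lam)"
    and service_rv: "\<And>k. random_variable borel (S k)"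
    and service_distr: "\<And>k. distr M borel (S k) = B"
    and service_nonneg: "AE x in B. 0 \<le> x"
    and mean_service: "0 < (\<integral>\<^sup>+x. ennreal x \<partial>B)" "(\<integral>\<^sup>+x. ennreal x \<partial>B) < \<infinity>"
    and indep: "indep_vars (\<lambda>_. borel) (case_sum A S) UNIV"

definition arrival_time :: "(nat \<Rightarrow> 'a \<Rightarrow> real) \<Rightarrow> 'a \<Rightarrow> nat \<Rightarrow> real" where
  "arrival_time A \<omega> i = (\<Sum>j\<le>i. A j \<omega>)"

text \<open>\<open>expected_processed M A S n\<close> is the expectation of \<open>P\<^sub>n\<close>.\<close>
definition expected_processed ::
    "'a measure \<Rightarrow> (nat \<Rightarrow> 'a \<Rightarrow> real) \<Rightarrow> (nat \<Rightarrow> 'a \<Rightarrow> real) \<Rightarrow> nat \<Rightarrow> ennreal" where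
  "expected_processed M A S n =
     (\<integral>\<^sup>+\<omega>. processed n (arrival_time A \<omega>) (\<lambda>k. S k \<omega>) \<partial>M)"

definition rho :: "real \<Rightarrow> real measure \<Rightarrow> nat \<Rightarrow> ennreal" where
  "rho lam B j = ennreal (lam ^ j) * (\<integral>\<^sup>+x\<in>{0..}. ennreal (x ^ j) \<partial>B)"

end

theory Submission
  imports Defs
begin

text \<open>
During a busy period the server works without pause, so a busy period is governed by the numbers
\<open>\<nu>\<^sub>1, \<nu>\<^sub>2, ...\<close> of messages that arrive during the successive services. The interarrival times
have no memory and are independent of the service times; hence these numbers are i.i.d. with the
mixed Poisson distribution \<open>\<pi>\<close> (\<open>arrivals_prob\<close>), and the number of messages in the system at
departures is a Markov chain: a service that starts with \<open>x\<close> messages and sees \<open>j\<close> arrivals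
leaves \<open>min (x + j) (n + 1) - 1\<close> messages behind. The number of processed messages is the time
at which this chain, started at \<open>1\<close>, reaches \<open>0\<close>.

Let \<open>r l\<close> (\<open>tail\<close>) be the probability of more than \<open>l\<close> arrivals during a service. The chain
moves down in steps of one, and from \<open>x\<close> to \<open>x - 1\<close> it behaves as in a busy period of a system
with \<open>n + 1 - x\<close> waiting places. So one expects, writing \<open>Q m\<close> for the mean number of services
in a busy period with \<open>m\<close> waiting places, the recurrence
\<open>Q m = 1 + (\<Sum>l<m. r l * Q (m - l))\<close>. It is solved by \<open>Q m = (\<Sum>i<m. u i)\<close> for \<open>m > 0\<close>,
where \<open>u\<close> is the renewal sequence of \<open>r\<close> (\<open>renewal_sum_recurrence\<close>). That this \<open>Q\<close> is the
mean is verified analytically: the sums of \<open>Q\<close> solve the equations for the expected hitting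
times of \<open>0\<close> (\<open>mean_remaining_step\<close>), and the maximum principle shows that these equations have
only one solution with finite values.

Consequently \<open>Q (n + 1) - Q n = u n\<close> for \<open>n > 0\<close>. If \<open>\<rho>\<^sub>1 = 1\<close>, then \<open>\<pi>\<close> has mean \<open>1\<close>, so \<open>r\<close> is
a probability distribution; its mean is half the second factorial moment of \<open>\<pi>\<close>, that is
\<open>\<rho>\<^sub>2 / 2\<close>. The renewal theorem yields \<open>u n \<longlonglongrightarrow> 2 / \<rho>\<^sub>2\<close>.
\<close>

section \<open>The renewal theorem\<close>

text \<open>
With \<open>w = 1\<close> this is the tail formula for the mean of a distribution on the natural numbers;
with \<open>w k = k\<close> it says that the tails, regarded as a distribution themselves, have as mean half
the second factorial moment of the original one. Summation by parts leaves a boundary term,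
which is dominated by the remainder of the convergent series of the hypothesis.
\<close>
lemma weighted_tail_sums:
  fixes f w :: "nat \<Rightarrow> real"
  assumes f: "\<And>i. 0 \<le> f i" "f sums 1" and w: "\<And>k. 0 \<le> w k"
    and mean: "(\<lambda>i. (\<Sum>k<i. w k) * f i) sums \<mu>"
  shows "(\<lambda>k. w k * (1 - (\<Sum>i\<le>k. f i))) sums \<mu>"
proof -
  define W where "W i = (\<Sum>k<i. w k)" for i
  have W_mono: "W i \<le> W j" if "i \<le> j" for i j
    unfolding W_def using that w by (intro sum_mono2) auto
  have parts: "(\<Sum>k<n. w k * (1 - (\<Sum>i\<le>k. f i))) =
      W n * (1 - (\<Sum>i<n. f i)) + (\<Sum>i<n. W i * f i)" for n
    by (induction n) (simp_all add: W_def lessThan_Suc_atMost[symmetric] algebra_simps)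
  have mean': "(\<lambda>i. W i * f i) sums \<mu>"
    using mean by (simp add: W_def)
  have bound: "0 \<le> W n * (1 - (\<Sum>i<n. f i)) \<and>
      W n * (1 - (\<Sum>i<n. f i)) \<le> \<mu> - (\<Sum>i<n. W i * f i)" for n
  proof -
    have t: "(\<lambda>i. f (i + n)) sums (1 - (\<Sum>i<n. f i))"
      using f(2) by (simp add: sums_iff_shift)
    have t2: "(\<lambda>i. W (i + n) * f (i + n)) sums (\<mu> - (\<Sum>i<n. W i * f i))"
      using sums_iff_shift[of "\<lambda>i. W i * f i" n] mean' by simp
    have "0 \<le> 1 - (\<Sum>i<n. f i)"
      using sums_le[OF _ sums_zero t] f(1) by auto
    moreover have "0 \<le> W n"
      unfolding W_def by (intro sum_nonneg w)
    moreover have "W n * (1 - (\<Sum>i<n. f i)) \<le> \<mu> - (\<Sum>i<n. W i * f i)"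
      by (rule sums_le[OF _ sums_mult[OF t] t2]) (intro mult_right_mono W_mono f, simp)
    ultimately show ?thesis by simp
  qed
  have lim: "(\<lambda>n. \<Sum>i<n. W i * f i) \<longlonglongrightarrow> \<mu>"
    using mean' by (simp add: sums_def)
  have "(\<lambda>n. W n * (1 - (\<Sum>i<n. f i))) \<longlonglongrightarrow> 0"
    by (rule tendsto_sandwich[where f="\<lambda>_. 0" and h="\<lambda>n. \<mu> - (\<Sum>i<n. W i * f i)"])
       (use bound lim in \<open>auto intro!: always_eventually tendsto_eq_intros\<close>)
  from tendsto_add[OF this lim] show ?thesis
    unfolding sums_def parts by simp
qed

text \<open>
The value \<open>v (m j)\<close> is an average of earlier values with weights \<open>f\<close>. If it tends to the upper
limit \<open>L\<close> of the sequence, none of the averaged values can stay below \<open>L\<close>: the weighted excesses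
over \<open>L\<close> tend to \<open>0\<close> by dominated convergence, hence so do the weighted deficits.
\<close>
lemma convolution_limit_at_extremum:
  fixes f v :: "nat \<Rightarrow> real" and m :: "nat \<Rightarrow> nat"
  assumes f: "\<And>i. 0 \<le> f i" "f sums 1"
    and bdd: "\<And>n. \<bar>v n\<bar> \<le> C"
    and renewal: "eventually (\<lambda>n. v n = (\<Sum>k\<le>n. f k * v (n - k))) sequentially"
    and upper: "\<And>e. e > 0 \<Longrightarrow> eventually (\<lambda>n. v n \<le> L + e) sequentially"
    and m: "filterlim m at_top sequentially" and lim: "(\<lambda>j. v (m j)) \<longlonglongrightarrow> L"
    and pos: "f i > 0"
  shows "(\<lambda>j. v (m j - i)) \<longlonglongrightarrow> L"
proof -
  define d where "d k j = (if k \<le> m j then L - v (m j - k) else 0)" for k j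
  have C0: "0 \<le> C" using bdd[of 0] by simp
  have d_bdd: "\<bar>d k j\<bar> \<le> \<bar>L\<bar> + C" for k j
    unfolding d_def using bdd[of "m j - k"] C0 by auto
  have d_finite: "d k j = 0" if "k \<notin> {..m j}" for k j
    using that by (simp add: d_def)
  have sumf: "(\<lambda>k. f k * (\<bar>L\<bar> + C)) sums (1 * (\<bar>L\<bar> + C))"
    by (rule sums_mult2[OF f(2)])
  have mk: "filterlim (\<lambda>j. m j - k) at_top sequentially" for k
    using m by (rule filterlim_compose[OF filterlim_minus_const_nat_at_top])
  \<comment> \<open>\<open>d k j\<close> is the deficit of the \<open>k\<close>-th averaged value, \<open>g k j\<close> the weighted excess.\<close>
  define g where "g k j = f k * max 0 (- d k j)" for k j
  have g_lim: "(\<lambda>j. g k j) \<longlonglongrightarrow> 0" for k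
  proof -
    have "(\<lambda>j. max 0 (- d k j)) \<longlonglongrightarrow> 0"
    proof (rule tendstoI)
      fix e :: real assume e: "e > 0"
      have "eventually (\<lambda>j. v (m j - k) \<le> L + e/2) sequentially"
        using eventually_compose_filterlim[OF upper[of "e/2"] mk[of k]] e by simp
      then show "eventually (\<lambda>j. dist (max 0 (- d k j)) 0 < e) sequentially"
        by eventually_elim (use e in \<open>auto simp: d_def\<close>)
    qed
    from tendsto_mult_left[OF this, of "f k"] show ?thesis
      by (simp add: g_def)
  qed
  have g_sum: "(\<lambda>j. \<Sum>k. g k j) \<longlonglongrightarrow> (\<Sum>k. 0)"
  proof (rule tannerys_theorem[THEN conjunct2, THEN conjunct2])
    show "(\<lambda>j. g k j) \<longlonglongrightarrow> 0" for k by (rule g_lim)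
    show "\<forall>\<^sub>F (k, j) in at_top \<times>\<^sub>F sequentially. norm (g k j) \<le> f k * (\<bar>L\<bar> + C)"
    proof (rule always_eventually, clarify)
      fix k j
      show "norm (g k j) \<le> f k * (\<bar>L\<bar> + C)"
        unfolding g_def real_norm_def abs_mult using d_bdd[of k j] f(1)[of k]
        by (intro mult_mono) auto
    qed
    show "summable (\<lambda>k. f k * (\<bar>L\<bar> + C))"
      using sumf by (rule sums_summable)
  qed simp
  have d_sum: "(\<lambda>j. \<Sum>k. f k * d k j) \<longlonglongrightarrow> 0"
  proof -
    have "(\<lambda>n. \<Sum>k\<le>n. f k) \<longlonglongrightarrow> 1"
      using f(2) by (simp add: sums_def_le)
    then have "(\<lambda>j. (\<Sum>k\<le>m j. f k)) \<longlonglongrightarrow> 1"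
      using m by (rule filterlim_compose)
    then have 1: "(\<lambda>j. L * (\<Sum>k\<le>m j. f k) - v (m j)) \<longlonglongrightarrow> 0"
      by (auto intro!: tendsto_eq_intros lim)
    have "eventually (\<lambda>j. v (m j) = (\<Sum>k\<le>m j. f k * v (m j - k))) sequentially"
      by (rule eventually_compose_filterlim[OF renewal m])
    then have "eventually (\<lambda>j. L * (\<Sum>k\<le>m j. f k) - v (m j) = (\<Sum>k. f k * d k j)) sequentially"
    proof eventually_elim
      case (elim j)
      have "(\<Sum>k. f k * d k j) = (\<Sum>k\<le>m j. f k * d k j)"
        by (rule suminf_finite) (auto simp: d_finite)
      also have "\<dots> = L * (\<Sum>k\<le>m j. f k) - (\<Sum>k\<le>m j. f k * v (m j - k))"
        by (simp add: d_def algebra_simps sum_subtractf sum_distrib_left)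
      finally show ?case using elim by simp
    qed
    with 1 show ?thesis by (rule Lim_transform_eventually)
  qed
  have le: "\<bar>f i * d i j\<bar> \<le> (\<Sum>k. f k * d k j) + 2 * (\<Sum>k. g k j)" for j
  proof -
    have gd: "g k j = 0" if "k \<notin> {..m j}" for k
      using d_finite[OF that] by (simp add: g_def)
    have 0: "f i * \<bar>d i j\<bar> = 0" if "i \<notin> {..m j}" using d_finite[OF that] by simp
    have "\<bar>f i * d i j\<bar> = f i * \<bar>d i j\<bar>" using f(1)[of i] by (simp add: abs_mult)
    also have "\<dots> \<le> (\<Sum>k\<le>m j. f k * \<bar>d k j\<bar>)"
    proof (cases "i \<in> {..m j}")
      case True
      then show ?thesis
        using member_le_sum[of i "{..m j}" "\<lambda>k. f k * \<bar>d k j\<bar>"] f(1) by simp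
    next
      case False
      then show ?thesis unfolding 0[OF False]
        by (intro sum_nonneg mult_nonneg_nonneg f(1) abs_ge_zero)
    qed
    also have "\<dots> = (\<Sum>k\<le>m j. f k * d k j) + 2 * (\<Sum>k\<le>m j. g k j)"
    proof -
      have "\<bar>x\<bar> = x + 2 * max 0 (- x)" for x :: real by simp
      then have "f k * \<bar>d k j\<bar> = f k * d k j + 2 * g k j" for k
        unfolding g_def by (metis distrib_left mult.left_commute)
      then show ?thesis
        by (simp only: sum.distrib sum_distrib_left)
    qed
    also have "(\<Sum>k\<le>m j. f k * d k j) = (\<Sum>k. f k * d k j)"
      by (rule suminf_finite[symmetric]) (auto simp: d_finite)
    also have "(\<Sum>k\<le>m j. g k j) = (\<Sum>k. g k j)"
      by (rule suminf_finite[symmetric]) (auto simp: gd)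
    finally show ?thesis .
  qed
  have "(\<lambda>j. (\<Sum>k. f k * d k j) + 2 * (\<Sum>k. g k j)) \<longlonglongrightarrow> 0"
    using d_sum g_sum by (auto intro!: tendsto_eq_intros)
  then have "(\<lambda>j. f i * d i j) \<longlonglongrightarrow> 0"
    by (rule Lim_null_comparison[OF always_eventually, rotated]) (use le in auto)
  from tendsto_mult_left[OF this, of "inverse (f i)"] have "(\<lambda>j. d i j) \<longlonglongrightarrow> 0"
    using pos by simp
  then have "(\<lambda>j. L - d i j) \<longlonglongrightarrow> L"
    by (auto intro!: tendsto_eq_intros)
  moreover have "eventually (\<lambda>j. L - d i j = v (m j - i)) sequentially"
    using m[unfolded filterlim_at_top, rule_format, of i]
    by eventually_elim (simp add: d_def)
  ultimately show ?thesis by (rule Lim_transform_eventually)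
qed

text \<open>
Since \<open>f 1 > 0\<close>, the limit \<open>L\<close> along \<open>m\<close> passes to the shifts of \<open>m\<close> by \<open>1, 2, ...\<close>, so that the
conserved quantity \<open>total\<close> can be evaluated along \<open>m\<close> by dominated convergence.
\<close>
lemma renewal_extremal_limit:
  fixes f T v :: "nat \<Rightarrow> real" and m :: "nat \<Rightarrow> nat"
  assumes f: "\<And>i. 0 \<le> f i" "f sums 1" "f 1 > 0"
    and T: "\<And>k. 0 \<le> T k" "T sums \<mu>"
    and bdd: "\<And>n. \<bar>v n\<bar> \<le> C"
    and renewal: "eventually (\<lambda>n. v n = (\<Sum>k\<le>n. f k * v (n - k))) sequentially"
    and upper: "\<And>e. e > 0 \<Longrightarrow> eventually (\<lambda>n. v n \<le> L + e) sequentially"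
    and m: "filterlim m at_top sequentially" and lim: "(\<lambda>j. v (m j)) \<longlonglongrightarrow> L"
    and total: "\<And>n. (\<Sum>k\<le>n. T k * v (n - k)) = c"
  shows "\<mu> * L = c"
proof -
  have shift: "(\<lambda>j. v (m j - i)) \<longlonglongrightarrow> L" for i
  proof (induction i)
    case 0 show ?case using lim by simp
  next
    case (Suc i)
    have "filterlim (\<lambda>j. m j - i) at_top sequentially"
      using m by (rule filterlim_compose[OF filterlim_minus_const_nat_at_top])
    from convolution_limit_at_extremum[OF f(1,2) bdd renewal upper this Suc f(3)]
    show ?case by simp
  qed
  define a where "a k j = (if k \<le> m j then T k * v (m j - k) else 0)" for k j
  have C0: "0 \<le> C" using bdd[of 0] by simp
  have "(\<lambda>j. \<Sum>k. a k j) \<longlonglongrightarrow> (\<Sum>k. T k * L)"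
  proof (rule tannerys_theorem[THEN conjunct2, THEN conjunct2])
    show "(\<lambda>j. a k j) \<longlonglongrightarrow> T k * L" for k
    proof -
      have "(\<lambda>j. T k * v (m j - k)) \<longlonglongrightarrow> T k * L"
        by (intro tendsto_mult_left shift)
      moreover have "eventually (\<lambda>j. T k * v (m j - k) = a k j) sequentially"
        using m[unfolded filterlim_at_top, rule_format, of k]
        by eventually_elim (simp add: a_def)
      ultimately show ?thesis by (rule Lim_transform_eventually)
    qed
    show "\<forall>\<^sub>F (k, j) in at_top \<times>\<^sub>F sequentially. norm (a k j) \<le> T k * C"
    proof (rule always_eventually, clarify)
      fix k j
      show "norm (a k j) \<le> T k * C"
        using T(1)[of k] C0 bdd[of "m j - k"]
        by (auto simp: a_def abs_mult intro!: mult_left_mono)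
    qed
    show "summable (\<lambda>k. T k * C)"
      using T(2) by (intro summable_mult2 sums_summable)
  qed simp
  moreover have "(\<Sum>k. a k j) = c" for j
  proof -
    have "(\<Sum>k. a k j) = (\<Sum>k\<le>m j. a k j)"
      by (rule suminf_finite) (auto simp: a_def)
    then show ?thesis using total[of "m j"] by (simp add: a_def)
  qed
  ultimately have "(\<lambda>j::nat. c) \<longlonglongrightarrow> (\<Sum>k. T k * L)" by simp
  then have "c = (\<Sum>k. T k * L)"
    by (simp add: LIMSEQ_const_iff)
  also have "\<dots> = \<mu> * L"
    using sums_mult2[OF T(2), of L] by (simp add: sums_iff)
  finally show ?thesis by simp
qed

lemma bounded_limsup_subsequence:
  fixes v :: "nat \<Rightarrow> real"
  assumes "\<And>n. \<bar>v n\<bar> \<le> C"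
  obtains L m where "filterlim m at_top sequentially" "(\<lambda>j. v (m j)) \<longlonglongrightarrow> L"
    "\<And>e. e > 0 \<Longrightarrow> eventually (\<lambda>n. v n \<le> L + e) sequentially"
proof -
  let ?w = "\<lambda>n. ereal (v n)"
  obtain m where m: "strict_mono m" "(?w \<circ> m) \<longlonglongrightarrow> limsup ?w"
    using limsup_subseq_lim by blast
  have "ereal (-C) \<le> limsup ?w"
    by (rule tendsto_lowerbound[OF m(2)]) (use assms[THEN abs_le_D2] in \<open>auto intro!: always_eventually simp: minus_le_iff\<close>)
  moreover have "limsup ?w \<le> ereal C"
    by (rule tendsto_upperbound[OF m(2)]) (use assms[THEN abs_le_D1] in \<open>auto intro!: always_eventually\<close>)
  ultimately obtain L where L: "limsup ?w = ereal L"
    by (cases "limsup ?w") auto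
  show ?thesis
  proof
    show "filterlim m at_top sequentially"
      using m(1) by (rule filterlim_subseq)
    show "(\<lambda>j. v (m j)) \<longlonglongrightarrow> L"
      using m(2) by (simp add: L o_def)
    fix e :: real assume "e > 0"
    then have "limsup ?w < ereal (L + e)" by (simp add: L)
    then have "eventually (\<lambda>n. ?w n < ereal (L + e)) sequentially"
      by (rule Limsup_lessD)
    then show "eventually (\<lambda>n. v n \<le> L + e) sequentially"
      by eventually_elim simp
  qed
qed

text \<open>
The theorem of Erdos, Feller and Pollard in the case \<open>f 1 > 0\<close>, where \<open>f 0 > 0\<close> is permitted. If
\<open>T\<close> denotes the tails of \<open>f\<close>, then the convolution of \<open>T\<close> and \<open>u\<close> is constantly \<open>1\<close>, so that the
upper limit \<open>L\<close> of \<open>u\<close> satisfies \<open>\<mu> * L = 1\<close>. The same applied to \<open>- u\<close> determines the lower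
limit.
\<close>
theorem renewal_theorem:
  fixes f u :: "nat \<Rightarrow> real"
  assumes f: "\<And>i. 0 \<le> f i" "f sums 1" "f 1 > 0"
    and mean: "(\<lambda>i. real i * f i) sums \<mu>"
    and renewal: "\<And>n. u n = (if n = 0 then 1 else 0) + (\<Sum>k\<le>n. f k * u (n - k))"
  shows "u \<longlonglongrightarrow> 1 / \<mu>"
proof -
  define T where "T k = 1 - (\<Sum>i\<le>k. f i)" for k
  have T_sums: "T sums \<mu>"
    using weighted_tail_sums[OF f(1,2), of "\<lambda>_. 1" \<mu>] mean by (simp add: T_def[abs_def])
  have T_nonneg: "0 \<le> T k" for k
    using sum_le_suminf[OF sums_summable[OF f(2)], of "{..k}"] f(1,2)
    by (simp add: T_def sums_iff)
  have T0: "T 0 > 0"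
  proof -
    have "0 \<le> T 1" by (rule T_nonneg)
    then show ?thesis using f(3) by (simp add: T_def)
  qed
  have mu: "\<mu> > 0"
  proof -
    have "(\<Sum>k\<in>{0}. T k) \<le> suminf T"
      using T_sums T_nonneg by (intro sum_le_suminf) (auto simp: sums_iff)
    then show ?thesis using T0 T_sums by (simp add: sums_iff)
  qed
  have u_nonneg: "0 \<le> u n" for n
  proof (induction n rule: less_induct)
    case (less n)
    have "{..n} = insert 0 {1..n}" by auto
    then have "u n = (if n = 0 then 1 else 0) + (f 0 * u n + (\<Sum>k=1..n. f k * u (n - k)))"
      by (subst renewal) simp
    then have "T 0 * u n = (if n = 0 then 1 else 0) + (\<Sum>k=1..n. f k * u (n - k))"
      by (simp add: T_def left_diff_distrib)
    moreover have "0 \<le> (\<Sum>k=1..n. f k * u (n - k))"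
      by (intro sum_nonneg mult_nonneg_nonneg f less) auto
    ultimately have "0 \<le> T 0 * u n" by simp
    then show ?case using T0 by (simp add: zero_le_mult_iff)
  qed
  \<comment> \<open>By \<open>T_Suc\<close> the convolution changes at each step by the difference of the two sides of the renewal equation, which vanishes.\<close>
  have total: "(\<Sum>k\<le>n. T k * u (n - k)) = 1" for n
  proof (induction n)
    case 0
    have "u 0 = 1 + f 0 * u 0" by (subst renewal) simp
    then show ?case by (simp add: T_def left_diff_distrib)
  next
    case (Suc n)
    have T_Suc: "T (Suc k) = T k - f (Suc k)" for k by (simp add: T_def)
    have "(\<Sum>k\<le>Suc n. T k * u (Suc n - k)) = T 0 * u (Suc n) + (\<Sum>k\<le>n. T (Suc k) * u (n - k))"
      by (subst sum.atMost_Suc_shift) simp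
    also have "\<dots> = u (Suc n) - (f 0 * u (Suc n) + (\<Sum>k\<le>n. f (Suc k) * u (n - k)))
        + (\<Sum>k\<le>n. T k * u (n - k))"
      by (simp add: T_Suc algebra_simps sum_subtractf) (simp add: T_def algebra_simps)
    also have "f 0 * u (Suc n) + (\<Sum>k\<le>n. f (Suc k) * u (n - k)) = u (Suc n)"
      by (subst (3) renewal, subst sum.atMost_Suc_shift) simp
    finally show ?case using Suc by simp
  qed
  have bdd: "\<bar>u n\<bar> \<le> 1 / T 0" for n
  proof -
    have "T 0 * u (n - 0) \<le> (\<Sum>k\<le>n. T k * u (n - k))"
      by (rule member_le_sum) (auto intro!: mult_nonneg_nonneg T_nonneg u_nonneg)
    then show ?thesis using T0 u_nonneg[of n] total[of n] by (simp add: field_simps)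
  qed
  have renewal': "eventually (\<lambda>n. u n = (\<Sum>k\<le>n. f k * u (n - k))) sequentially"
    using eventually_gt_at_top[of 0]
  proof eventually_elim
    case (elim n)
    then show ?case by (subst renewal) simp
  qed
  have upper: "eventually (\<lambda>n. u n \<le> 1/\<mu> + e) sequentially" if "e > 0" for e
  proof -
    obtain m L where L: "filterlim m at_top sequentially" "(\<lambda>j. u (m j)) \<longlonglongrightarrow> L"
      "\<And>e. e > 0 \<Longrightarrow> eventually (\<lambda>n. u n \<le> L + e) sequentially"
      by (rule bounded_limsup_subsequence[of u, OF bdd]) (rule that)
    have "\<mu> * L = 1"
      by (rule renewal_extremal_limit[OF f T_nonneg T_sums bdd renewal' L(3,1,2) total])
    then have "L = 1/\<mu>" using mu by (simp add: field_simps)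
    with L(3)[OF that] show ?thesis by simp
  qed
  have lower: "eventually (\<lambda>n. u n \<ge> 1/\<mu> - e) sequentially" if "e > 0" for e
  proof -
    have bdd': "\<bar>- u n\<bar> \<le> 1 / T 0" for n using bdd by simp
    obtain m L where L: "filterlim m at_top sequentially" "(\<lambda>j. - u (m j)) \<longlonglongrightarrow> L"
      "\<And>e. e > 0 \<Longrightarrow> eventually (\<lambda>n. - u n \<le> L + e) sequentially"
      by (rule bounded_limsup_subsequence[of "\<lambda>n. - u n", OF bdd']) (rule that)
    have "\<mu> * L = - 1"
      by (rule renewal_extremal_limit[where v="\<lambda>n. - u n", OF f T_nonneg T_sums bdd' _ L(3,1,2)])
         (use renewal' total in \<open>auto simp: sum_negf\<close>)
    then have "L = - 1/\<mu>" using mu by (simp add: field_simps)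
    then show ?thesis
      using L(3)[OF that] by (auto elim!: eventually_mono)
  qed
  show ?thesis
  proof (rule tendstoI)
    fix e :: real assume "e > 0"
    then have e: "e/2 > 0" "e/2 < e" by auto
    show "eventually (\<lambda>n. dist (u n) (1/\<mu>) < e) sequentially"
      using upper[OF e(1)] lower[OF e(1)]
      by eventually_elim (use e in \<open>auto simp: dist_real_def abs_if\<close>)
  qed
qed

text \<open>
The solution \<open>u\<close> of the renewal equation for \<open>r\<close>, written in resolved form because the term with
\<open>r 0\<close> contains \<open>u n\<close> itself.
\<close>
fun renewal_seq :: "(nat \<Rightarrow> real) \<Rightarrow> nat \<Rightarrow> real" where
  "renewal_seq r n =
    ((if n = 0 then 1 else 0) + (\<Sum>k=1..n. r k * renewal_seq r (n - k))) / (1 - r 0)"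

declare renewal_seq.simps [simp del]

lemma renewal_seq_eq:
  assumes "r 0 \<noteq> 1"
  shows "renewal_seq r n = (if n = 0 then 1 else 0) + (\<Sum>k\<le>n. r k * renewal_seq r (n - k))"
proof -
  have "(1 - r 0) * renewal_seq r n = (if n = 0 then 1 else 0) + (\<Sum>k=1..n. r k * renewal_seq r (n - k))"
    using assms by (subst renewal_seq.simps) simp
  moreover have "{..n} = insert 0 {1..n}" by auto
  ultimately show ?thesis by (simp add: left_diff_distrib)
qed

lemma renewal_seq_nonneg:
  assumes "\<And>k. 0 \<le> r k" "r 0 < 1"
  shows "0 \<le> renewal_seq r n"
proof (induction n rule: less_induct)
  case (less n)
  have "0 \<le> (\<Sum>k=1..n. r k * renewal_seq r (n - k))"
    by (intro sum_nonneg mult_nonneg_nonneg assms less) auto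
  then show ?case using assms(2) by (subst renewal_seq.simps) simp
qed

text \<open>
For the tails \<open>r\<close> of the number of arrivals during a service, this turns out to be the mean
number of services in a busy period of the system with \<open>m\<close> waiting places. The value at \<open>0\<close> is
the one service of a system without waiting places; it is not an empty sum.
\<close>
definition renewal_sum :: "(nat \<Rightarrow> real) \<Rightarrow> nat \<Rightarrow> real" where
  "renewal_sum r m = (if m = 0 then 1 else \<Sum>i<m. renewal_seq r i)"

lemma renewal_sum_nonneg:
  assumes "\<And>k. 0 \<le> r k" "r 0 < 1"
  shows "0 \<le> renewal_sum r n"
  unfolding renewal_sum_def using renewal_seq_nonneg[of r, OF assms] by (auto intro: sum_nonneg)

text \<open>
This is the renewal equation summed over the indices below \<open>m\<close>: the inhomogeneous term
contributes the \<open>1\<close>, and taking partial sums commutes with the convolution.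
\<close>
lemma renewal_sum_recurrence:
  assumes "r 0 \<noteq> 1"
  shows "renewal_sum r m = 1 + (\<Sum>l<m. r l * renewal_sum r (m - l))"
proof (cases "m = 0")
  case False
  define W where "W m = (\<Sum>i<m. renewal_seq r i)" for m
  have "W m = (if m = 0 then 0 else 1) + (\<Sum>l<m. r l * W (m - l))"
  proof (induction m)
    case (Suc m)
    have "(\<Sum>l<Suc m. r l * W (Suc m - l)) = (\<Sum>l\<le>m. r l * (W (m - l) + renewal_seq r (m - l)))"
      unfolding lessThan_Suc_atMost by (intro sum.cong refl) (simp add: W_def Suc_diff_le)
    also have "\<dots> = (\<Sum>l\<le>m. r l * W (m - l)) + (\<Sum>l\<le>m. r l * renewal_seq r (m - l))"
      by (simp add: distrib_left sum.distrib)
    also have "(\<Sum>l\<le>m. r l * W (m - l)) = (\<Sum>l<m. r l * W (m - l))"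
      by (simp add: lessThan_Suc_atMost[symmetric] W_def)
    also have "(\<Sum>l\<le>m. r l * renewal_seq r (m - l)) = renewal_seq r m - (if m = 0 then 1 else 0)"
      using renewal_seq_eq[of r m, OF assms] by linarith
    finally have "(if Suc m = 0 then 0 else 1) + (\<Sum>l<Suc m. r l * W (Suc m - l)) = W m + renewal_seq r m"
      using Suc by simp
    then show ?case by (simp add: W_def)
  qed (simp add: W_def)
  with False have "W m = 1 + (\<Sum>l<m. r l * W (m - l))" by simp
  moreover have "(\<Sum>l<m. r l * renewal_sum r (m - l)) = (\<Sum>l<m. r l * W (m - l))"
    by (intro sum.cong) (auto simp: renewal_sum_def W_def)
  ultimately show ?thesis using False by (simp add: renewal_sum_def W_def)
qed (simp add: renewal_sum_def)

section \<open>The trajectory of a busy period\<close>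

text \<open>
The interarrival times from some moment on form a stream. \<open>arrivals_before j t as\<close> says that
exactly \<open>j\<close> of the arrivals fall before \<open>t\<close> and none at \<open>t\<close>, and then \<open>residual j t as\<close> is the
stream of interarrival times seen from \<open>t\<close>. Excluding an arrival at the moment of a departure,
an event of probability \<open>0\<close>, avoids having to say which of the two comes first.
\<close>
fun arrivals_before :: "nat \<Rightarrow> real \<Rightarrow> real stream \<Rightarrow> bool" where
  "arrivals_before 0 t as = (t < shd as)"
| "arrivals_before (Suc j) t as = (shd as < t \<and> arrivals_before j (t - shd as) (stl as))"

fun residual :: "nat \<Rightarrow> real \<Rightarrow> real stream \<Rightarrow> real stream" where
  "residual 0 t as = (shd as - t) ## stl as"
| "residual (Suc j) t as = residual j (t - shd as) (stl as)"

text \<open>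
The number of messages left behind by a departure, if the service began with \<open>x\<close> messages in the
system and \<open>j\<close> arrived during it: at most \<open>Suc n\<close> messages fit into the system.
\<close>
definition after_service :: "nat \<Rightarrow> nat \<Rightarrow> nat \<Rightarrow> nat" where
  "after_service n x j = min (x + j) (Suc n) - 1"

text \<open>
A busy period that begins with \<open>x\<close> messages in the system, with a fresh service starting,
consists of exactly \<open>K\<close> services. There is no such \<open>K\<close> if the busy period does not end, or if an
arrival coincides with one of its departures.
\<close>
fun busy_services :: "nat \<Rightarrow> nat \<Rightarrow> nat \<Rightarrow> real stream \<Rightarrow> real stream \<Rightarrow> bool" where
  "busy_services n 0 x as ss = (x = 0)"
| "busy_services n (Suc K) x as ss =
     (x > 0 \<and> (\<exists>j. arrivals_before j (shd ss) as \<and>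
        busy_services n K (after_service n x j) (residual j (shd ss) as) (stl ss)))"

lemma arrivals_before_sums:
  "arrivals_before j t as \<longleftrightarrow> (\<forall>i<j. (\<Sum>m\<le>i. as !! m) < t) \<and> t < (\<Sum>m\<le>j. as !! m)"
proof (induction j arbitrary: t as)
  case (Suc j)
  have *: "(\<Sum>m\<le>Suc i. as !! m) = shd as + (\<Sum>m\<le>i. stl as !! m)" for i
    by (simp only: sum.atMost_Suc_shift snth.simps)
  have "(\<forall>i<Suc j. (\<Sum>m\<le>i. as !! m) < t) \<longleftrightarrow>
      shd as < t \<and> (\<forall>i<j. (\<Sum>m\<le>Suc i. as !! m) < t)"
    by (auto simp: less_Suc_eq_0_disj simp del: sum.atMost_Suc)
  then show ?case by (simp add: Suc * del: sum.atMost_Suc) (auto simp: algebra_simps)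
qed simp

lemma arrivals_before_unique:
  "arrivals_before j t as \<Longrightarrow> arrivals_before j' t as \<Longrightarrow> j = j'"
proof (induction j arbitrary: j' t as)
  case 0 then show ?case by (cases j') auto
next
  case (Suc j) then show ?case by (cases j') auto
qed

lemma residual_sums: "(\<Sum>m\<le>i. residual j t as !! m) = (\<Sum>m\<le>i + j. as !! m) - t"
proof (induction j arbitrary: t as)
  case 0
  show ?case by (induction i) simp_all
next
  case (Suc j)
  have "(\<Sum>m\<le>i + Suc j. as !! m) = shd as + (\<Sum>m\<le>i + j. stl as !! m)"
    by (simp only: add_Suc_right sum.atMost_Suc_shift snth.simps)
  with Suc show ?case by simp
qed

lemma length_departures: "length (departures n T S m) = card {i. i < m \<and> accepted n T S i}"
proof (induction m)
  case (Suc m)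
  have "{i. i < Suc m \<and> accepted n T S i} =
      (if accepted n T S m then insert m {i. i < m \<and> accepted n T S i} else {i. i < m \<and> accepted n T S i})"
    by (auto simp: less_Suc_eq)
  then show ?case using Suc by (simp add: Let_def accepted_def)
qed simp

lemma departures_Suc_accepted:
  "accepted n T S i \<Longrightarrow> departures n T S (Suc i) = departures n T S i @ [departure n T S i]"
  by (simp add: accepted_def departure_def Let_def)

lemma departures_nth:
  assumes "k < length (departures n T S m)"
  obtains i where "i < m" "accepted n T S i" "departure n T S i = departures n T S m ! k"
  using assms
proof (induction m arbitrary: thesis)
  case (Suc m)
  show ?case
  proof (cases "accepted n T S m")
    case True
    show ?thesis
    proof (cases "k < length (departures n T S m)")
      case k: True
      obtain i where "i < m" "accepted n T S i" "departure n T S i = departures n T S m ! k"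
        using Suc.IH k by blast
      then show ?thesis
        using k departures_Suc_accepted[OF True] by (intro Suc.prems(1)[of i]) (auto simp: nth_append)
    next
      case False
      then have "k = length (departures n T S m)"
        using Suc.prems(2) departures_Suc_accepted[OF True] by simp
      then show ?thesis
        using departures_Suc_accepted[OF True] True
        by (intro Suc.prems(1)[of m]) (auto simp: nth_append)
    qed
  next
    case False
    then have "departures n T S (Suc m) = departures n T S m"
      by (simp add: accepted_def Let_def)
    with Suc.prems(2) obtain i where "i < m" "accepted n T S i" "departure n T S i = departures n T S m ! k"
      using Suc.IH by (metis (no_types))
    then show ?thesis
      using \<open>departures n T S (Suc m) = departures n T S m\<close> by (intro Suc.prems(1)[of i]) auto
  qed
qed simp

lemma departure_mem:
  assumes "i < m" "accepted n T S i"
  shows "departure n T S i \<in> set (departures n T S m)"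
  using assms(1)
proof (induction m)
  case (Suc m)
  show ?case
  proof (cases "i = m")
    case True
    then show ?thesis using departures_Suc_accepted[OF assms(2)] by simp
  next
    case False
    with Suc have "departure n T S i \<in> set (departures n T S m)" by simp
    then show ?thesis by (simp add: Let_def)
  qed
qed simp

lemma departure_ge_arrival:
  assumes "accepted n T S i" "\<And>k. 0 \<le> S k"
  shows "T i \<le> departure n T S i"
proof -
  define ds where "ds = departures n T S i"
  have "departure n T S i = (if ds = [] then T i else max (T i) (last ds)) + S (length ds)"
    using assms(1) by (simp add: departure_def accepted_def Let_def ds_def)
  then show ?thesis using assms(2)[of "length ds"] by auto
qed

definition service_end :: "(nat \<Rightarrow> real) \<Rightarrow> (nat \<Rightarrow> real) \<Rightarrow> nat \<Rightarrow> real" where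
  "service_end T S k = T 0 + (\<Sum>l<k. S l)"

lemma service_end_mono: "(\<And>k. 0 \<le> S k) \<Longrightarrow> k \<le> l \<Longrightarrow> service_end T S k \<le> service_end T S l"
  unfolding service_end_def by (auto intro!: sum_mono2)

text \<open>
During the \<open>k\<close>-th service no message leaves, so the messages in the system are those accepted
after the first \<open>k\<close>, and each further arrival is accepted until there are \<open>Suc n\<close> of them. Since
the server does not idle, the epochs of departure are the partial sums of the service times.
\<close>
lemma departures_within_service:
  assumes S: "\<And>k. 0 \<le> S k"
    and start: "departures n T S i = map (\<lambda>m. service_end T S (Suc m)) [0..<k + x]"
    and x: "0 < x" "x \<le> Suc n"
    and before: "\<And>l. l < j \<Longrightarrow> service_end T S k \<le> T (i + l) \<and> T (i + l) < service_end T S (Suc k)"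
    and "l \<le> j"
  shows "departures n T S (i + l) =
    map (\<lambda>m. service_end T S (Suc m)) [0..<k + min (x + l) (Suc n)]"
  using \<open>l \<le> j\<close>
proof (induction l)
  case 0
  then show ?case using start x by (simp add: min_absorb1)
next
  case (Suc l)
  \<comment> \<open>The number of messages accepted so far.\<close>
  define L where "L = k + min (x + l) (Suc n)"
  let ?D = "\<lambda>m. service_end T S (Suc m)"
  define ds where "ds = departures n T S (i + l)"
  have ds: "ds = map ?D [0..<L]" using Suc by (simp add: ds_def L_def)
  have L: "k < L" using x by (auto simp: L_def)
  have T: "service_end T S k \<le> T (i + l)" "T (i + l) < ?D k"
    using before[of l] Suc.prems by auto
  have gt: "T (i + l) < ?D m \<longleftrightarrow> k \<le> m" for m
    using T service_end_mono[where S=S, OF S, of "Suc m" k T] service_end_mono[where S=S, OF S, of "Suc k" "Suc m" T]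
    by (cases "k \<le> m") auto
  have "filter (\<lambda>d. T (i + l) < d) ds = map ?D (filter (\<lambda>m. k \<le> m) [0..<L])"
    by (simp add: ds filter_map o_def gt)
  also have "filter (\<lambda>m. k \<le> m) [0..<L] = [k..<L]"
    using L by (induction L) (auto simp: le_less_Suc_eq not_le less_Suc_eq)
  finally have len: "length (filter (\<lambda>d. T (i + l) < d) ds) = min (x + l) (Suc n)"
    by (simp add: L_def)
  have last: "last ds = ?D (L - 1)"
    using L by (simp add: ds last_map last_upt)
  have "T (i + l) < ?D (L - 1)" using gt[of "L - 1"] L by simp
  then have new: "max (T (i + l)) (last ds) + S (length ds) = ?D L"
    using L by (cases L) (simp_all add: last ds service_end_def)
  have ne: "ds \<noteq> []" using L by (simp add: ds)
  have step: "departures n T S (i + Suc l) =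
      (if min (x + l) (Suc n) \<le> n then ds @ [?D L] else ds)"
    unfolding len[symmetric] new[symmetric] using ne by (simp add: Let_def ds_def[symmetric])
  show ?case
  proof (cases "min (x + l) (Suc n) \<le> n")
    case True
    then have "k + min (x + Suc l) (Suc n) = Suc L" by (auto simp: L_def)
    then show ?thesis unfolding step using True by (simp only: if_True) (simp add: ds)
  next
    case False
    then have "k + min (x + Suc l) (Suc n) = L" by (auto simp: L_def)
    then show ?thesis unfolding step using False by (simp only: if_False) (simp add: ds)
  qed
qed

text \<open>
The hypotheses describe the beginning of the \<open>k\<close>-th service: \<open>x\<close> messages are in the system, and
message \<open>i\<close> is the next one to arrive. They are reproduced at the beginning of the following
service, which allows an induction on the number \<open>K\<close> of services still to come.
\<close>
lemma busy_period_trajectory: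
  assumes S: "\<And>k. 0 \<le> S k" and T: "mono T"
    and "departures n T S i = map (\<lambda>m. service_end T S (Suc m)) [0..<k + x]"
    and "x \<le> Suc n"
    and "\<And>i'. i' < i \<Longrightarrow> T i' \<le> service_end T S k"
    and "service_end T S k < T i"
    and "\<And>l. T (i + l) = service_end T S k + (\<Sum>m\<le>l. as !! m)"
    and "\<And>m. ss !! m = S (k + m)"
    and "busy_services n K x as ss"
  shows "\<exists>m. departures n T S m = map (\<lambda>m. service_end T S (Suc m)) [0..<k + K] \<and>
    service_end T S (k + K) < T m \<and>
    (\<forall>t. service_end T S k \<le> t \<and> t < service_end T S (k + K) \<longrightarrow> in_system n T S t \<noteq> {})"
  using assms(3-)
proof (induction K arbitrary: k i x as ss)
  case 0
  then show ?case by (intro exI[of _ i]) auto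
next
  case (Suc K)
  let ?D = "service_end T S"
  from Suc.prems(7) obtain j where x: "x > 0" and j: "arrivals_before j (shd ss) as"
    and rest: "busy_services n K (after_service n x j) (residual j (shd ss) as) (stl ss)"
    by auto
  have shd: "shd ss = S k" using Suc.prems(6)[of 0] by simp
  have Dk: "?D (Suc k) = ?D k + shd ss" by (simp add: service_end_def shd)
  have before: "?D k \<le> T (i + l) \<and> T (i + l) < ?D (Suc k)" if "l < j" for l
    using j that Suc.prems(4) monoD[OF T, of i "i + l"]
    by (auto simp: arrivals_before_sums Suc.prems(5) Dk)
  have after: "?D (Suc k) < T (i + j)"
    using j by (simp add: arrivals_before_sums Suc.prems(5) Dk)
  have deps: "departures n T S (i + j) =
      map (\<lambda>m. ?D (Suc m)) [0..<k + min (x + j) (Suc n)]"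
    by (rule departures_within_service[OF S Suc.prems(1) x Suc.prems(2) before order_refl])
  have occupied: "in_system n T S t \<noteq> {}" if "?D k \<le> t" "t < ?D (Suc k)" for t
  proof -
    have "k < length (departures n T S i)" using x Suc.prems(1) by simp
    then obtain i' where i': "i' < i" "accepted n T S i'" "departure n T S i' = departures n T S i ! k"
      by (rule departures_nth)
    then have "departure n T S i' = ?D (Suc k)" using x by (simp add: Suc.prems(1))
    with i' have "i' \<in> in_system n T S t"
      using that Suc.prems(3)[of i'] by (auto simp: in_system_def)
    then show ?thesis by blast
  qed
  have "\<exists>m. departures n T S m = map (\<lambda>m. ?D (Suc m)) [0..<Suc k + K] \<and> ?D (Suc k + K) < T m \<and>
      (\<forall>t. ?D (Suc k) \<le> t \<and> t < ?D (Suc k + K) \<longrightarrow> in_system n T S t \<noteq> {})"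
  proof (rule Suc.IH[OF _ _ _ _ _ _ rest])
    show "departures n T S (i + j) = map (\<lambda>m. ?D (Suc m)) [0..<Suc k + after_service n x j]"
      using deps x by (simp add: after_service_def)
    show "after_service n x j \<le> Suc n" by (simp add: after_service_def)
    show "T i' \<le> ?D (Suc k)" if "i' < i + j" for i'
    proof (cases "i' < i")
      case True
      then show ?thesis
        using Suc.prems(3)[of i'] service_end_mono[where S=S, OF S, of k "Suc k" T] by simp
    next
      case False
      with that have "i' - i < j" by arith
      with False show ?thesis using before[of "i' - i"] by simp
    qed
    show "?D (Suc k) < T (i + j)" by (rule after)
    show "T (i + j + l) = ?D (Suc k) + (\<Sum>m\<le>l. residual j (shd ss) as !! m)" for l
      using Suc.prems(5)[of "l + j"] by (simp add: residual_sums Dk ac_simps)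
    show "stl ss !! m = S (Suc k + m)" for m
      using Suc.prems(6)[of "Suc m"] by simp
  qed
  then show ?case using occupied by (auto simp: not_less) (meson not_less)
qed

text \<open>
At the end of the last of the \<open>K\<close> services the system is empty for the first time. The accepted
messages with departures up to then are those that arrived before then, and there are \<open>K\<close> of
them.
\<close>
lemma processed_eq_services:
  assumes S: "\<And>k. 0 \<le> S k" and T: "mono T"
    and as: "\<And>l. T (Suc l) = T 0 + (\<Sum>m\<le>l. as !! m)" and as0: "0 < shd as"
    and ss: "\<And>m. ss !! m = S m"
    and busy: "busy_services n K 1 as ss"
  shows "processed n T S = of_nat K"
proof -
  let ?D = "service_end T S"
  have D0: "?D 0 = T 0" by (simp add: service_end_def)
  have T1: "T 0 < T 1" using as[of 0] as0 by simp
  obtain m where m: "departures n T S m = map (\<lambda>m. ?D (Suc m)) [0..<K]" "?D K < T m"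
    and occupied: "\<And>t. T 0 \<le> t \<Longrightarrow> t < ?D K \<Longrightarrow> in_system n T S t \<noteq> {}"
  proof -
    have "\<exists>m. departures n T S m = map (\<lambda>m. ?D (Suc m)) [0..<0 + K] \<and> ?D (0 + K) < T m \<and>
      (\<forall>t. ?D 0 \<le> t \<and> t < ?D (0 + K) \<longrightarrow> in_system n T S t \<noteq> {})"
    proof (rule busy_period_trajectory[OF S T _ _ _ _ _ _ busy])
      show "departures n T S 1 = map (\<lambda>m. ?D (Suc m)) [0..<0 + 1]"
        by (simp add: Let_def service_end_def)
      show "T (1 + l) = ?D 0 + (\<Sum>m\<le>l. as !! m)" for l using as[of l] by (simp add: D0)
      show "?D 0 < T 1" using T1 by (simp add: D0)
    qed (auto simp: D0 ss)
    then show thesis using that by (auto simp: D0)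
  qed
  have late: "\<not> accepted n T S i \<or> ?D K < departure n T S i" if "m \<le> i" for i
    using departure_ge_arrival[of n T S i] S m(2) monoD[OF T that] by fastforce
  have early: "departure n T S i \<le> ?D K" if "i < m" "accepted n T S i" for i
  proof -
    have "departure n T S i \<in> set (departures n T S m)" by (rule departure_mem) fact+
    then show ?thesis by (auto simp: m(1) intro!: service_end_mono S)
  qed
  have empty: "in_system n T S (?D K) = {}"
  proof -
    have "i \<notin> in_system n T S (?D K)" for i
      using early[of i] m(2) monoD[OF T, of m i] by (cases "i < m") (auto simp: in_system_def)
    then show ?thesis by blast
  qed
  have "busy_period_end n T S = ereal (?D K)"
    unfolding busy_period_end_def
  proof (rule antisym)
    show "Inf (ereal ` {t. T 0 \<le> t \<and> in_system n T S t = {}}) \<le> ereal (?D K)"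
      using empty service_end_mono[where S=S, OF S, of 0 K T] by (intro Inf_lower) (auto simp: D0)
    show "ereal (?D K) \<le> Inf (ereal ` {t. T 0 \<le> t \<and> in_system n T S t = {}})"
      using occupied by (intro Inf_greatest) (force simp: not_less)
  qed
  then have "{i. accepted n T S i \<and> ereal (departure n T S i) \<le> busy_period_end n T S} =
      {i. i < m \<and> accepted n T S i}"
    using late early by (force simp: not_le)
  moreover have "card {i. i < m \<and> accepted n T S i} = K"
    using length_departures[of n T S m] by (simp add: m(1))
  ultimately show ?thesis by (simp add: processed_def)
qed

section \<open>Poisson arrivals and the number of services\<close>

lemma measurable_arrivals_before [measurable (raw)]:
  assumes "f \<in> borel_measurable N" "g \<in> N \<rightarrow>\<^sub>M stream_space borel"
  shows "Measurable.pred N (\<lambda>x. arrivals_before j (f x) (g x))"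
  using assms
proof (induction j arbitrary: f g)
  case 0
  note 0[measurable]
  show ?case by simp
next
  case (Suc j)
  note Suc.prems[measurable]
  have [measurable]: "Measurable.pred N (\<lambda>x. arrivals_before j (f x - shd (g x)) (stl (g x)))"
    by (rule Suc.IH) measurable
  show ?case by simp
qed

lemma measurable_residual [measurable (raw)]:
  assumes "f \<in> borel_measurable N" "g \<in> N \<rightarrow>\<^sub>M stream_space borel"
  shows "(\<lambda>x. residual j (f x) (g x)) \<in> N \<rightarrow>\<^sub>M stream_space borel"
  using assms
proof (induction j arbitrary: f g)
  case 0
  note 0[measurable]
  show ?case by simp
next
  case (Suc j)
  note Suc.prems[measurable]
  show ?case unfolding residual.simps by (rule Suc.IH) measurable
qed

lemma measurable_busy_services [measurable (raw)]:
  assumes "f \<in> N \<rightarrow>\<^sub>M stream_space borel" "g \<in> N \<rightarrow>\<^sub>M stream_space borel"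
  shows "Measurable.pred N (\<lambda>\<omega>. busy_services n K x (f \<omega>) (g \<omega>))"
  using assms
proof (induction K arbitrary: f g x)
  case 0
  then show ?case by simp
next
  case (Suc K)
  note Suc.prems[measurable]
  have [measurable]: "Measurable.pred N (\<lambda>\<omega>. busy_services n K (after_service n x j)
      (residual j (shd (g \<omega>)) (f \<omega>)) (stl (g \<omega>)))" for j
    by (rule Suc.IH) measurable
  show ?case by simp
qed

abbreviation exponential_measure :: "real \<Rightarrow> real measure" where
  "exponential_measure lam \<equiv> density lborel (\<lambda>x. ennreal (exponential_density lam x))"

text \<open>
The Poisson probabilities as a formula, which covers parameter \<open>0\<close>: service times may vanish
with positive probability.
\<close>
definition poisson_prob :: "real \<Rightarrow> nat \<Rightarrow> real" where
  "poisson_prob c j = c ^ j / fact j * exp (- c)"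

text \<open>
The first arrival at \<open>a\<close> leaves \<open>j\<close> further arrivals for the remaining time \<open>t - a\<close>.
\<close>
lemma poisson_density_convolution:
  assumes "0 < lam" "0 \<le> t"
  shows "(\<integral>\<^sup>+a. ennreal (exponential_density lam a) *
      (indicator {..<t} a * ennreal (poisson_prob (lam * (t - a)) j)) \<partial>lborel) =
    ennreal (poisson_prob (lam * t) (Suc j))"
proof -
  let ?f = "\<lambda>a. exp (- lam * t) * lam * (lam * (t - a)) ^ j / fact j"
  let ?F = "\<lambda>a. - exp (- lam * t) * (lam * (t - a)) ^ Suc j / fact (Suc j)"
  have "(\<integral>\<^sup>+a. ennreal (exponential_density lam a) *
      (indicator {..<t} a * ennreal (poisson_prob (lam * (t - a)) j)) \<partial>lborel) =
      (\<integral>\<^sup>+a. ennreal (?f a) * indicator {0..t} a \<partial>lborel)"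
  proof (rule nn_integral_cong_AE)
    show "AE a in lborel. ennreal (exponential_density lam a) *
      (indicator {..<t} a * ennreal (poisson_prob (lam * (t - a)) j)) =
      ennreal (?f a) * indicator {0..t} a"
      using AE_lborel_singleton[of t]
    proof eventually_elim
      case (elim a)
      show ?case
      proof (cases "0 \<le> a \<and> a < t")
        case True
        have "exponential_density lam a * poisson_prob (lam * (t - a)) j = ?f a"
          using True assms
          by (simp add: exponential_density_def poisson_prob_def field_simps exp_diff exp_minus exp_add)
        then show ?thesis using True assms
          by (simp add: ennreal_mult'[symmetric] exponential_density_nonneg)
      next
        case False
        then show ?thesis using elim
          by (auto simp: exponential_density_def indicator_def)
      qed
    qed
  qed
  also have "\<dots> = ennreal (?F t - ?F 0)"
  proof (rule nn_integral_FTC_Icc)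
    show "DERIV ?F a :> ?f a" if "a \<in> {0..t}" for a
    proof -
      have "((\<lambda>a. (lam * (t - a)) ^ Suc j) has_real_derivative
          (1 + real j) * (- lam * (lam * (t - a)) ^ j)) (at a)"
        by (rule DERIV_power_Suc) (auto intro!: derivative_eq_intros)
      from DERIV_cdivide[OF DERIV_cmult[OF this, of "- exp (- lam * t)"], of "fact (Suc j)"]
      have "DERIV ?F a :> - exp (- lam * t) * ((1 + real j) * (- lam * (lam * (t - a)) ^ j)) / fact (Suc j)" .
      also have "- exp (- lam * t) * ((1 + real j) * (- lam * (lam * (t - a)) ^ j)) / fact (Suc j) =
          ((1 + real j) * (exp (- lam * t) * lam * (lam * (t - a)) ^ j)) / ((1 + real j) * fact j)"
        by simp
      also have "\<dots> = ?f a"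
        by (rule mult_divide_mult_cancel_left) simp
      finally show ?thesis .
    qed
  qed (use assms in auto)
  also have "?F t - ?F 0 = poisson_prob (lam * t) (Suc j)"
    by (simp add: poisson_prob_def)
  finally show ?thesis .
qed

text \<open>
The number of arrivals before \<open>t\<close> is Poisson distributed, and the arrivals after \<open>t\<close> form a
fresh copy of the process that is independent of this number. For \<open>j = 0\<close> this is the lack of
memory of the first interarrival time; for the induction step one conditions on the first
interarrival time.
\<close>
lemma nn_integral_arrivals_before:
  assumes lam: "0 < lam" and F [measurable]: "F \<in> borel_measurable (stream_space borel)"
    and "0 \<le> t"
  defines "SE \<equiv> stream_space (exponential_measure lam)"
  shows "(\<integral>\<^sup>+as. indicator {as. arrivals_before j t as} as * F (residual j t as) \<partial>SE) =
    ennreal (poisson_prob (lam * t) j) * (\<integral>\<^sup>+as. F as \<partial>SE)"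
  using \<open>0 \<le> t\<close>
proof (induction j arbitrary: t)
  interpret E: prob_space "exponential_measure lam"
    by (rule prob_space_exponential_density) fact
  interpret SE: prob_space SE
    unfolding SE_def by (rule E.prob_space_stream_space)
  have sets_SE [measurable_cong]: "sets SE = sets (stream_space borel)"
    unfolding SE_def by (rule sets_stream_space_cong) simp
  have split: "(\<integral>\<^sup>+as. G as \<partial>SE) =
      (\<integral>\<^sup>+a. ennreal (exponential_density lam a) * (\<integral>\<^sup>+as. G (a ## as) \<partial>SE) \<partial>lborel)"
    if G [measurable]: "G \<in> borel_measurable (stream_space borel)" for G
  proof -
    have "(\<integral>\<^sup>+as. G as \<partial>SE) = (\<integral>\<^sup>+a. \<integral>\<^sup>+as. G (a ## as) \<partial>SE \<partial>exponential_measure lam)"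
      unfolding SE_def
      by (rule E.nn_integral_stream_space) (simp add: measurable_cong_sets[OF sets_SE[unfolded SE_def] refl])
    also have "\<dots> = (\<integral>\<^sup>+a. ennreal (exponential_density lam a) * (\<integral>\<^sup>+as. G (a ## as) \<partial>SE) \<partial>lborel)"
      by (rule nn_integral_density) measurable
    finally show ?thesis .
  qed
  {
    case 0
    \<comment> \<open>Lack of memory amounts to the substitution \<open>a = t + b\<close> in the integral over the first interarrival time.\<close>
    define \<Phi> where "\<Phi> a = (\<integral>\<^sup>+as. F (a ## as) \<partial>SE)" for a
    have [measurable]: "\<Phi> \<in> borel_measurable borel"
      unfolding \<Phi>_def by measurable
    have "(\<integral>\<^sup>+as. indicator {as. arrivals_before 0 t as} as * F (residual 0 t as) \<partial>SE) =
        (\<integral>\<^sup>+a. ennreal (exponential_density lam a) *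
          (\<integral>\<^sup>+as. indicator {as. arrivals_before 0 t as} (a ## as) * F (residual 0 t (a ## as)) \<partial>SE) \<partial>lborel)"
      by (rule split) measurable
    also have "\<dots> = (\<integral>\<^sup>+a. ennreal (exponential_density lam a) * (indicator {t<..} a * \<Phi> (a - t)) \<partial>lborel)"
      by (intro nn_integral_cong) (simp add: \<Phi>_def indicator_def)
    also have "\<dots> = (\<integral>\<^sup>+b. ennreal (exponential_density lam (t + b)) * (indicator {t<..} (t + b) * \<Phi> b) \<partial>lborel)"
      by (subst nn_integral_real_affine[where c=1 and t=t]) simp_all
    also have "\<dots> = (\<integral>\<^sup>+b. ennreal (exp (- lam * t)) * (ennreal (exponential_density lam b) * \<Phi> b) \<partial>lborel)"
    proof (rule nn_integral_cong_AE)
      show "AE b in lborel. ennreal (exponential_density lam (t + b)) * (indicator {t<..} (t + b) * \<Phi> b) =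
          ennreal (exp (- lam * t)) * (ennreal (exponential_density lam b) * \<Phi> b)"
        using AE_lborel_singleton[of 0]
      proof eventually_elim
        case (elim b)
        show ?case
        proof (cases "0 < b")
          case True
          have "exponential_density lam (t + b) = exp (- lam * t) * exponential_density lam b"
            using True 0 by (simp add: exponential_density_def exp_add[symmetric] algebra_simps)
          then show ?thesis using True lam
            by (simp add: ennreal_mult' mult.assoc exponential_density_nonneg)
        next
          case False
          then show ?thesis using elim by (simp add: exponential_density_def)
        qed
      qed
    qed
    also have "\<dots> = ennreal (exp (- lam * t)) * (\<integral>\<^sup>+as. F as \<partial>SE)"
      unfolding split[OF F] by (subst nn_integral_cmult) (simp_all add: \<Phi>_def[symmetric])
    also have "exp (- lam * t) = poisson_prob (lam * t) 0"
      using 0 lam by (simp add: poisson_prob_def)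
    finally show ?case .
  next
    case (Suc j)
    have "(\<integral>\<^sup>+as. indicator {as. arrivals_before (Suc j) t as} as * F (residual (Suc j) t as) \<partial>SE) =
        (\<integral>\<^sup>+a. ennreal (exponential_density lam a) *
          (\<integral>\<^sup>+as. indicator {as. arrivals_before (Suc j) t as} (a ## as) * F (residual (Suc j) t (a ## as)) \<partial>SE) \<partial>lborel)"
      by (rule split) measurable
    also have "\<dots> = (\<integral>\<^sup>+a. ennreal (exponential_density lam a) *
      (indicator {..<t} a * ennreal (poisson_prob (lam * (t - a)) j)) * (\<integral>\<^sup>+as. F as \<partial>SE) \<partial>lborel)"
    proof (rule nn_integral_cong)
      fix a :: real
      show "ennreal (exponential_density lam a) *
          (\<integral>\<^sup>+as. indicator {as. arrivals_before (Suc j) t as} (a ## as) * F (residual (Suc j) t (a ## as)) \<partial>SE) =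
        ennreal (exponential_density lam a) *
          (indicator {..<t} a * ennreal (poisson_prob (lam * (t - a)) j)) * (\<integral>\<^sup>+as. F as \<partial>SE)"
      proof (cases "a < t")
        case True
        have "(\<integral>\<^sup>+as. indicator {as. arrivals_before (Suc j) t as} (a ## as) * F (residual (Suc j) t (a ## as)) \<partial>SE) =
          (\<integral>\<^sup>+as. indicator {as. arrivals_before j (t - a) as} as * F (residual j (t - a) as) \<partial>SE)"
          using True by (intro nn_integral_cong) (simp add: indicator_def)
        also have "\<dots> = ennreal (poisson_prob (lam * (t - a)) j) * (\<integral>\<^sup>+as. F as \<partial>SE)"
          using True by (intro Suc.IH) simp
        finally show ?thesis using True by (simp add: mult.assoc)
      qed (simp add: indicator_def)
    qed
    also have "\<dots> = ennreal (poisson_prob (lam * t) (Suc j)) * (\<integral>\<^sup>+as. F as \<partial>SE)"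
    proof (subst nn_integral_multc)
      show "(\<lambda>a. ennreal (exponential_density lam a) * (indicator {..<t} a *
          ennreal (poisson_prob (lam * (t - a)) j))) \<in> borel_measurable lborel"
        unfolding poisson_prob_def by measurable
    qed (subst poisson_density_convolution, use lam Suc.prems in auto)
    finally show ?case .
  }
qed


text \<open>
The mixed Poisson distribution of the number of arrivals during a service whose length has
distribution \<open>B\<close>.
\<close>
definition arrivals_prob :: "real \<Rightarrow> real measure \<Rightarrow> nat \<Rightarrow> real" where
  "arrivals_prob lam B j = (\<integral>x. poisson_prob (lam * x) j \<partial>B)"

lemma poisson_prob_nonneg: "0 \<le> c \<Longrightarrow> 0 \<le> poisson_prob c j"
  by (simp add: poisson_prob_def)

lemma poisson_prob_sums: "poisson_prob c sums 1"
proof -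
  have "(\<lambda>j. c ^ j / fact j * exp (- c)) sums (exp c * exp (- c))"
    using exp_converges[of c] by (intro sums_mult2) (simp add: divide_inverse mult.commute)
  then show ?thesis by (simp add: poisson_prob_def[abs_def] exp_minus)
qed

lemma poisson_prob_le_1: "0 \<le> c \<Longrightarrow> poisson_prob c j \<le> 1"
  using sum_le_suminf[of "poisson_prob c" "{j}"] poisson_prob_sums[of c]
  by (simp add: sums_iff poisson_prob_nonneg)

lemma poisson_prob_Suc: "real (Suc j) * poisson_prob c (Suc j) = c * poisson_prob c j"
proof -
  have "real (Suc j) * poisson_prob c (Suc j) =
      (real (Suc j) * (c * (c ^ j * exp (- c)))) / (real (Suc j) * fact j)"
    by (simp add: poisson_prob_def)
  also have "\<dots> = c * (c ^ j * exp (- c)) / fact j"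
    by (rule mult_divide_mult_cancel_left) simp
  finally show ?thesis by (simp add: poisson_prob_def)
qed

lemma poisson_prob_mean: "(\<lambda>j. real j * poisson_prob c j) sums c"
  using sums_Suc[where f="\<lambda>j. real j * poisson_prob c j"] sums_mult[OF poisson_prob_sums, of c c]
  unfolding poisson_prob_Suc by simp

lemma poisson_prob_factorial_moment:
  "(\<lambda>j. real (j * (j - 1)) / 2 * poisson_prob c j) sums (c\<^sup>2 / 2)"
proof -
  have *: "real (Suc j * (Suc j - 1)) / 2 * poisson_prob c (Suc j) = (c / 2) * (real j * poisson_prob c j)" for j
  proof -
    have "real (Suc j * (Suc j - 1)) / 2 * poisson_prob c (Suc j) =
        real j / 2 * (real (Suc j) * poisson_prob c (Suc j))"
      by (simp add: algebra_simps)
    then show ?thesis unfolding poisson_prob_Suc by simp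
  qed
  show ?thesis
    using sums_Suc[where f="\<lambda>j. real (j * (j - 1)) / 2 * poisson_prob c j"]
      sums_mult[OF poisson_prob_mean[of c], of "c / 2"]
    unfolding * by (simp add: power2_eq_square)
qed

lemma measurable_poisson_prob [measurable]: "(\<lambda>c. poisson_prob c j) \<in> borel_measurable borel"
  unfolding poisson_prob_def by measurable

lemma sums_of_suminf_ennreal:
  assumes "\<And>j. 0 \<le> f j" "(\<Sum>j. ennreal (f j)) = ennreal m" "0 \<le> m"
  shows "f sums m"
proof -
  have "summable f"
    by (rule summable_suminf_not_top) (use assms in auto)
  moreover from this have "ennreal (suminf f) = ennreal m"
    using assms by (simp add: suminf_ennreal2)
  ultimately show ?thesis
    using assms by (simp add: sums_iff suminf_nonneg)
qed

locale service_law = prob_space B for B :: "real measure" +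
  fixes lam :: real
  assumes rate: "0 < lam"
    and sets_B [measurable_cong, simp]: "sets B = sets borel"
    and nonneg: "AE x in B. 0 \<le> x"
begin

abbreviation (input) "\<pi> \<equiv> arrivals_prob lam B"

lemma ennreal_arrivals_prob: "(\<integral>\<^sup>+x. ennreal (poisson_prob (lam * x) j) \<partial>B) = ennreal (\<pi> j)"
  unfolding arrivals_prob_def
proof (rule nn_integral_eq_integral)
  show "AE x in B. 0 \<le> poisson_prob (lam * x) j"
    using nonneg by eventually_elim (simp add: poisson_prob_nonneg rate less_imp_le)
  show "integrable B (\<lambda>x. poisson_prob (lam * x) j)"
    by (rule integrable_const_bound[where B=1])
       (use nonneg rate in \<open>auto elim!: eventually_mono simp: poisson_prob_nonneg poisson_prob_le_1\<close>)
qed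

lemma arrivals_prob_nonneg: "0 \<le> \<pi> j"
  unfolding arrivals_prob_def
  by (rule integral_nonneg_AE)
     (use nonneg in eventually_elim, simp add: poisson_prob_nonneg rate less_imp_le)

text \<open>
Moments of the number of arrivals, obtained from those of the Poisson distribution by
integrating over the service time.
\<close>
lemma arrivals_prob_weighted:
  assumes w: "\<And>j. 0 \<le> w j"
    and sums: "\<And>c. 0 \<le> c \<Longrightarrow> (\<lambda>j. w j * poisson_prob c j) sums W c" and [measurable]: "W \<in> borel_measurable borel"
    and m: "(\<integral>\<^sup>+x. ennreal (W (lam * x)) \<partial>B) = ennreal m" "0 \<le> m"
  shows "(\<lambda>j. w j * \<pi> j) sums m"
proof -
  have "(\<Sum>j. ennreal (w j * \<pi> j)) = (\<Sum>j. \<integral>\<^sup>+x. ennreal (w j * poisson_prob (lam * x) j) \<partial>B)"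
    using w by (simp add: ennreal_mult' nn_integral_cmult ennreal_arrivals_prob)
  also have "\<dots> = (\<integral>\<^sup>+x. (\<Sum>j. ennreal (w j * poisson_prob (lam * x) j)) \<partial>B)"
    by (rule nn_integral_suminf[symmetric]) measurable
  also have "\<dots> = (\<integral>\<^sup>+x. ennreal (W (lam * x)) \<partial>B)"
  proof (rule nn_integral_cong_AE, use nonneg in eventually_elim)
    case (elim x)
    then have "0 \<le> lam * x" using rate by simp
    then show ?case
      using sums[of "lam * x"] w
      by (intro suminf_ennreal_eq) (auto simp: poisson_prob_nonneg)
  qed
  also have "\<dots> = ennreal m" by (rule m)
  finally have *: "(\<Sum>j. ennreal (w j * \<pi> j)) = ennreal m" .
  show ?thesis
    by (rule sums_of_suminf_ennreal[OF _ *]) (auto intro!: mult_nonneg_nonneg w arrivals_prob_nonneg m)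
qed

lemma arrivals_prob_sums: "\<pi> sums 1"
  using arrivals_prob_weighted[of "\<lambda>_. 1" "\<lambda>_. 1" 1] poisson_prob_sums by (simp add: emeasure_space_1)

lemma arrivals_prob_0_pos: "0 < \<pi> 0"
proof -
  have "(\<integral>\<^sup>+x. ennreal (poisson_prob (lam * x) 0) \<partial>B) \<noteq> 0"
    by (subst nn_integral_0_iff_AE) (simp_all add: poisson_prob_def AE_False ennreal_eq_0_iff not_le)
  then show ?thesis
    unfolding ennreal_arrivals_prob using arrivals_prob_nonneg[of 0] by (auto simp: less_le)
qed

abbreviation "SE \<equiv> stream_space (exponential_measure lam)"
abbreviation "SB \<equiv> stream_space B"

text \<open>
The arrivals are integrated out first: for a given length of the first service, the arrivals
beyond its end are replaced by a fresh stream before the remaining services are considered.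
\<close>
definition services_prob :: "nat \<Rightarrow> nat \<Rightarrow> nat \<Rightarrow> ennreal" where
  "services_prob n K x = (\<integral>\<^sup>+ss. \<integral>\<^sup>+as. indicator {as. busy_services n K x as ss} as \<partial>SE \<partial>SB)"

lemma prob_space_SE: "prob_space SE"
  by (intro prob_space.prob_space_stream_space prob_space_exponential_density rate)

lemma prob_space_SB: "prob_space SB"
  by (rule prob_space_stream_space)

lemma sets_SE [measurable_cong, simp]: "sets SE = sets (stream_space borel)"
  by (rule sets_stream_space_cong) simp

lemma sets_SB [measurable_cong, simp]: "sets SB = sets (stream_space borel)"
  by (rule sets_stream_space_cong) simp

text \<open>
The Markov property at the first departure. After integrating out the arrivals during the first
service, of length \<open>s\<close>, the residual arrivals and the remaining services are again distributed
as at the start.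
\<close>
lemma services_prob_Suc:
  "services_prob n (Suc K) x =
    (if x = 0 then 0 else \<Sum>j. ennreal (\<pi> j) * services_prob n K (after_service n x j))"
proof (cases "x = 0")
  case True
  then show ?thesis by (simp add: services_prob_def)
next
  case False
  interpret SE: prob_space SE by (rule prob_space_SE)
  let ?b = "\<lambda>K x as ss. indicator {as. busy_services n K x as ss} as :: ennreal"
  let ?I = "\<lambda>K x ss. \<integral>\<^sup>+as. ?b K x as ss \<partial>SE"
  let ?x = "after_service n x"
  have I [measurable]: "?I K x \<in> borel_measurable (stream_space borel)" for K x
    by measurable
  have step: "?b (Suc K) x as (s ## ss) =
      (\<Sum>j. indicator {as. arrivals_before j s as} as * ?b K (?x j) (residual j s as) ss)" for as s ss
  proof (cases "\<exists>j. arrivals_before j s as")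
    case True
    then obtain j where j: "arrivals_before j s as" by blast
    then have *: "arrivals_before j' s as \<longleftrightarrow> j' = j" for j'
      using arrivals_before_unique by blast
    have "(\<Sum>j. indicator {as. arrivals_before j s as} as * ?b K (?x j) (residual j s as) ss) =
        (\<Sum>j\<in>{j}. indicator {as. arrivals_before j s as} as * ?b K (?x j) (residual j s as) ss)"
      by (rule suminf_finite) (auto simp: *)
    then show ?thesis using False by (simp add: * indicator_def)
  qed (auto simp: indicator_def)
  have inner: "?I (Suc K) x (s ## ss) =
      (\<Sum>j. ennreal (poisson_prob (lam * s) j) * ?I K (?x j) ss)" if "0 \<le> s" for s ss
  proof -
    have "?I (Suc K) x (s ## ss) =
        (\<Sum>j. \<integral>\<^sup>+as. indicator {as. arrivals_before j s as} as * ?b K (?x j) (residual j s as) ss \<partial>SE)"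
      unfolding step by (rule nn_integral_suminf) (measurable, simp add: space_stream_space)
    also have "\<dots> = (\<Sum>j. ennreal (poisson_prob (lam * s) j) * ?I K (?x j) ss)"
      by (intro suminf_cong nn_integral_arrivals_before rate that)
         (measurable, simp add: space_stream_space)
    finally show ?thesis .
  qed
  have "services_prob n (Suc K) x = (\<integral>\<^sup>+s. \<integral>\<^sup>+ss. ?I (Suc K) x (s ## ss) \<partial>SB \<partial>B)"
    unfolding services_prob_def by (rule nn_integral_stream_space) measurable
  also have "\<dots> = (\<integral>\<^sup>+s. \<integral>\<^sup>+ss. (\<Sum>j. ennreal (poisson_prob (lam * s) j) * ?I K (?x j) ss) \<partial>SB \<partial>B)"
  proof (rule nn_integral_cong_AE, use nonneg in eventually_elim)
    case (elim s)
    then show ?case by (simp only: inner)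
  qed
  also have "\<dots> = (\<integral>\<^sup>+s. (\<Sum>j. ennreal (poisson_prob (lam * s) j) * services_prob n K (?x j)) \<partial>B)"
    by (intro nn_integral_cong)
       (simp add: nn_integral_suminf nn_integral_cmult services_prob_def)
  also have "\<dots> = (\<Sum>j. ennreal (\<pi> j) * services_prob n K (?x j))"
    by (simp add: nn_integral_suminf nn_integral_multc ennreal_arrivals_prob)
  finally show ?thesis using False by simp
qed

end

section \<open>The mean number of services\<close>

context service_law
begin

definition tail :: "nat \<Rightarrow> real" where "tail k = 1 - (\<Sum>i\<le>k. \<pi> i)"

lemma tail_nonneg: "0 \<le> tail k"
  using sum_le_suminf[OF sums_summable[OF arrivals_prob_sums], of "{..k}"]
    arrivals_prob_nonneg arrivals_prob_sums
  by (simp add: tail_def sums_iff)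

lemma tail_0_less_1: "tail 0 < 1"
  using arrivals_prob_0_pos by (simp add: tail_def)

lemma tail_sums: "(\<lambda>j. if l < j then \<pi> j else 0) sums tail l"
proof -
  have "(\<lambda>j. \<pi> j - (if j \<in> {..l} then \<pi> j else 0)) sums (1 - (\<Sum>j\<in>{..l}. \<pi> j))"
    by (intro sums_diff arrivals_prob_sums sums_If_finite_set) simp
  moreover have "(\<lambda>j. \<pi> j - (if j \<in> {..l} then \<pi> j else 0)) = (\<lambda>j. if l < j then \<pi> j else 0)"
    by auto
  ultimately show ?thesis by (simp add: tail_def)
qed

text \<open>
The mean number of services until the system is empty, starting with \<open>x\<close> messages. To get from
\<open>i + 1\<close> messages to \<open>i\<close> takes as many services as a busy period of a system with \<open>n - i\<close> waiting
places, whence the sum.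
\<close>
definition mean_remaining :: "nat \<Rightarrow> nat \<Rightarrow> real" where
  "mean_remaining n x = (\<Sum>i<x. renewal_sum tail (n - i))"

lemma mean_remaining_nonneg: "0 \<le> mean_remaining n x"
  unfolding mean_remaining_def
  by (intro sum_nonneg renewal_sum_nonneg tail_nonneg tail_0_less_1)

text \<open>
First-step analysis: this is the equation for the expected hitting time of \<open>0\<close>. Grouping the
terms of the left-hand side by the level \<open>l\<close> that the arrivals exceed turns it into the
recurrence for \<open>renewal_sum tail\<close>.
\<close>
lemma mean_remaining_step:
  assumes x: "0 < x" "x \<le> Suc n"
  shows "(\<lambda>j. \<pi> j * mean_remaining n (after_service n x j)) sums (mean_remaining n x - 1)"
proof -
  let ?Q = "renewal_sum tail"
  define m where "m = Suc n - x"
  obtain z where z: "x = Suc z" using x by (cases x) auto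
  have split: "mean_remaining n (after_service n x j) =
      mean_remaining n (x - 1) + (\<Sum>l<m. if l < j then ?Q (m - l) else 0)" for j
  proof -
    have "after_service n x j = (x - 1) + min j m"
      using x by (auto simp: after_service_def m_def)
    moreover have "(\<Sum>i<(x - 1) + p. ?Q (n - i)) = (\<Sum>i<x - 1. ?Q (n - i)) + (\<Sum>l<p. ?Q (m - l))" for p
      by (induction p) (simp_all add: m_def z)
    moreover have "(\<Sum>l<m. if l < j then ?Q (m - l) else 0) = (\<Sum>l<min j m. ?Q (m - l))"
      by (rule sum.mono_neutral_cong_right) auto
    ultimately show ?thesis by (simp add: mean_remaining_def)
  qed
  have "(\<lambda>j. \<pi> j * mean_remaining n (x - 1) + (\<Sum>l<m. (if l < j then \<pi> j else 0) * ?Q (m - l))) sums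
      (1 * mean_remaining n (x - 1) + (\<Sum>l<m. tail l * ?Q (m - l)))"
    by (intro sums_add sums_mult2 sums_sum tail_sums arrivals_prob_sums)
  moreover have "\<pi> j * mean_remaining n (x - 1) + (\<Sum>l<m. (if l < j then \<pi> j else 0) * ?Q (m - l)) =
      \<pi> j * mean_remaining n (after_service n x j)" for j
    unfolding split distrib_left sum_distrib_left by (intro arg_cong2[of _ _ _ _ "(+)"] sum.cong) auto
  moreover have "1 * mean_remaining n (x - 1) + (\<Sum>l<m. tail l * ?Q (m - l)) = mean_remaining n x - 1"
  proof -
    have "mean_remaining n x = mean_remaining n (x - 1) + ?Q m"
      using x by (cases x) (simp_all add: mean_remaining_def m_def)
    then show ?thesis
      using renewal_sum_recurrence[of tail m] tail_0_less_1 by simp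
  qed
  ultimately show ?thesis by simp
qed

text \<open>
At the least point where \<open>d\<close> is maximal, averaging forces \<open>d\<close> to be maximal also at the points
that can be reached from there. One of them is the next smaller point, since there is no arrival
with positive probability; so the least point is \<open>0\<close>.
\<close>
lemma maximum_principle:
  assumes d0: "d 0 = 0"
    and harmonic: "\<And>x. 0 < x \<Longrightarrow> x \<le> Suc n \<Longrightarrow> (\<lambda>j. \<pi> j * d (after_service n x j)) sums (d x :: real)"
    and "x \<le> Suc n"
  shows "d x \<le> 0"
proof -
  define D where "D = Max (d ` {..Suc n})"
  have D: "d y \<le> D" if "y \<le> Suc n" for y
    unfolding D_def using that by (intro Max_ge) auto
  have "D \<in> d ` {..Suc n}" unfolding D_def by (rule Max_in) auto
  then have ex: "\<exists>y. y \<le> Suc n \<and> d y = D" by auto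
  define y where "y = (LEAST y. y \<le> Suc n \<and> d y = D)"
  have y: "y \<le> Suc n" "d y = D" using LeastI_ex[OF ex] by (auto simp: y_def)
  have "y = 0"
  proof (rule ccontr)
    assume "y \<noteq> 0"
    then have "0 < y" by simp
    have "d (y - 1) \<noteq> D"
      using not_less_Least[of "y - 1" "\<lambda>y. y \<le> Suc n \<and> d y = D"] \<open>0 < y\<close> y by (auto simp: y_def[symmetric])
    moreover have "d (y - 1) \<le> D" by (rule D) (use y in simp)
    ultimately have less: "d (y - 1) < D" by simp
    have a: "after_service n y 0 = y - 1" using y by (simp add: after_service_def)
    let ?g = "\<lambda>j. \<pi> j * (D - d (after_service n y j))"
    have "?g sums (1 * D - d y)"
      unfolding right_diff_distrib
      by (intro sums_diff sums_mult2 arrivals_prob_sums harmonic \<open>0 < y\<close> y)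
    then have "?g sums 0" by (simp add: y)
    moreover have "0 \<le> ?g j" for j
      using D[of "after_service n y j"] arrivals_prob_nonneg by (simp add: after_service_def)
    moreover have "0 < ?g 0" using arrivals_prob_0_pos less by (simp add: a)
    ultimately show False
      using suminf_pos2[of ?g 0] by (simp add: sums_iff)
  qed
  then have "D = 0" using y d0 by simp
  with D \<open>x \<le> Suc n\<close> show ?thesis by simp
qed

lemma harmonic_unique:
  assumes "d 0 = 0"
    and "\<And>x. 0 < x \<Longrightarrow> x \<le> Suc n \<Longrightarrow> (\<lambda>j. \<pi> j * d (after_service n x j)) sums (d x :: real)"
    and "x \<le> Suc n"
  shows "d x = 0"
proof (rule antisym)
  show "d x \<le> 0" by (rule maximum_principle[OF assms])
  have "- d x \<le> 0"
    by (rule maximum_principle[of "\<lambda>x. - d x" n]) (use assms in \<open>auto intro: sums_minus\<close>)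
  then show "0 \<le> d x" by simp
qed

lemma services_prob_0: "services_prob n 0 x = (if x = 0 then 1 else 0)"
proof -
  interpret SE: prob_space SE by (rule prob_space_SE)
  interpret SB: prob_space SB by (rule prob_space_SB)
  show ?thesis by (simp add: services_prob_def SE.emeasure_space_1 SB.emeasure_space_1)
qed

lemma services_prob_empty: "services_prob n K 0 = (if K = 0 then 1 else 0)"
  by (cases K) (simp_all add: services_prob_0 services_prob_Suc)

text \<open>
Dependence on the first step for sums weighted with \<open>w\<close>; the constant weight \<open>1\<close> yields the
probability that the busy period ends, the weight \<open>of_nat\<close> the mean number of services.
\<close>
lemma services_prob_partial_sum:
  assumes "0 < x"
  shows "(\<Sum>K<Suc m. w K * services_prob n K x) =
    (\<Sum>j. ennreal (\<pi> j) * (\<Sum>K<m. w (Suc K) * services_prob n K (after_service n x j)))"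
proof -
  have "(\<Sum>K<Suc m. w K * services_prob n K x) = (\<Sum>K<m. w (Suc K) * services_prob n (Suc K) x)"
    using assms by (subst sum.lessThan_Suc_shift) (simp add: services_prob_0)
  also have "\<dots> = (\<Sum>K<m. \<Sum>j. ennreal (\<pi> j) * (w (Suc K) * services_prob n K (after_service n x j)))"
    using assms by (simp add: services_prob_Suc ennreal_suminf_cmult[symmetric] ac_simps del: ennreal_suminf_cmult)
  also have "\<dots> = (\<Sum>j. \<Sum>K<m. ennreal (\<pi> j) * (w (Suc K) * services_prob n K (after_service n x j)))"
    by (rule suminf_sum[symmetric]) simp
  finally show ?thesis by (simp add: sum_distrib_left)
qed

lemma services_prob_suminf:
  assumes "0 < x"
  shows "(\<Sum>K. w K * services_prob n K x) =
    (\<Sum>j. ennreal (\<pi> j) * (\<Sum>K. w (Suc K) * services_prob n K (after_service n x j)))"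
proof -
  let ?f = "\<lambda>K j. ennreal (\<pi> j) * (w (Suc K) * services_prob n K (after_service n x j))"
  have "(\<lambda>K. w (Suc K) * services_prob n (Suc K) x) sums (\<Sum>K. w (Suc K) * services_prob n (Suc K) x)"
    by (intro summable_sums summableI)
  from sums_Suc[OF this] have "(\<Sum>K. w K * services_prob n K x) = (\<Sum>K. w (Suc K) * services_prob n (Suc K) x)"
    using assms by (simp add: sums_iff services_prob_0)
  also have "\<dots> = (\<Sum>K. \<integral>\<^sup>+j. ?f K j \<partial>count_space UNIV)"
    using assms by (simp add: services_prob_Suc nn_integral_count_space_nat ennreal_suminf_cmult[symmetric] ac_simps del: ennreal_suminf_cmult)
  also have "\<dots> = (\<integral>\<^sup>+j. (\<Sum>K. ?f K j) \<partial>count_space UNIV)"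
    by (rule nn_integral_suminf[symmetric]) simp
  finally show ?thesis by (simp add: nn_integral_count_space_nat)
qed

text \<open>
The mean is finite because its truncations stay below \<open>mean_remaining\<close>, by induction along the
first step. So both series can be treated as real functions of \<open>x\<close>, and the maximum principle
applies.
\<close>
lemma services_prob_partial_bounds:
  shows "(\<Sum>K<m. services_prob n K x) \<le> 1"
    and "x \<le> Suc n \<Longrightarrow> (\<Sum>K<m. of_nat K * services_prob n K x) \<le> ennreal (mean_remaining n x)"
proof -
  have one: "(\<Sum>j. ennreal (\<pi> j)) = 1"
    using suminf_ennreal_eq[OF arrivals_prob_nonneg arrivals_prob_sums] by simp
  show total: "(\<Sum>K<m. services_prob n K x) \<le> 1" for m x
  proof (induction m arbitrary: x)
    case (Suc m)
    show ?case
    proof (cases "x = 0")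
      case True
      then show ?thesis by (simp add: services_prob_empty)
    next
      case False
      then have "(\<Sum>K<Suc m. services_prob n K x) =
          (\<Sum>j. ennreal (\<pi> j) * (\<Sum>K<m. services_prob n K (after_service n x j)))"
        using services_prob_partial_sum[of x "\<lambda>_. 1" n m] by simp
      also have "\<dots> \<le> (\<Sum>j. ennreal (\<pi> j) * 1)"
        by (intro suminf_le mult_left_mono Suc.IH) auto
      finally show ?thesis using one by simp
    qed
  qed simp
  show "x \<le> Suc n \<Longrightarrow> (\<Sum>K<m. of_nat K * services_prob n K x) \<le> ennreal (mean_remaining n x)"
  proof (induction m arbitrary: x)
    case (Suc m)
    show ?case
    proof (cases "x = 0")
      case True
      have "(\<Sum>K<Suc m. of_nat K * services_prob n K x) = 0"
        by (rule sum.neutral) (use True in \<open>simp add: services_prob_empty\<close>)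
      then show ?thesis by (simp only: zero_le)
    next
      case False
      let ?x = "after_service n x"
      have "(\<Sum>K<Suc m. of_nat K * services_prob n K x) =
          (\<Sum>j. ennreal (\<pi> j) * (\<Sum>K<m. of_nat (Suc K) * services_prob n K (?x j)))"
        using services_prob_partial_sum[of x of_nat n m] False by simp
      also have "\<dots> = (\<Sum>j. ennreal (\<pi> j) *
          ((\<Sum>K<m. of_nat K * services_prob n K (?x j)) + (\<Sum>K<m. services_prob n K (?x j))))"
        by (simp add: distrib_right sum.distrib add.commute)
      also have "\<dots> \<le> (\<Sum>j. ennreal (\<pi> j) * (ennreal (mean_remaining n (?x j)) + 1))"
        by (intro suminf_le mult_left_mono add_mono Suc.IH total) (auto simp: after_service_def)
      also have "\<dots> = (\<Sum>j. ennreal (\<pi> j * mean_remaining n (?x j) + \<pi> j))"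
        by (simp add: distrib_left ennreal_mult' ennreal_plus arrivals_prob_nonneg mean_remaining_nonneg)
      also have "\<dots> = ennreal (mean_remaining n x - 1 + 1)"
        by (intro suminf_ennreal_eq sums_add mean_remaining_step arrivals_prob_sums)
           (use False Suc.prems in \<open>auto simp: arrivals_prob_nonneg mean_remaining_nonneg\<close>)
      finally show ?thesis by simp
    qed
  qed simp
qed

lemma services_prob_total:
  assumes "x \<le> Suc n"
  shows "(\<Sum>K. services_prob n K x) = 1"
proof -
  define s where "s x = enn2real (\<Sum>K. services_prob n K x)" for x
  have s: "(\<Sum>K. services_prob n K x) = ennreal (s x)" for x
  proof -
    have "(\<Sum>K. services_prob n K x) \<le> 1"
      by (intro suminf_le_const services_prob_partial_bounds) simp
    then have "(\<Sum>K. services_prob n K x) < top"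
      by (rule le_less_trans) simp
    then show ?thesis by (simp add: s_def)
  qed
  have "1 - s x = 0"
  proof (rule harmonic_unique[where d="\<lambda>x. 1 - s x", OF _ _ assms])
    have "(\<Sum>K. services_prob n K 0) = (\<Sum>K\<in>{0}. services_prob n K 0)"
      by (rule suminf_finite) (simp_all add: services_prob_empty)
    then show "1 - s 0 = 0" by (simp add: s_def services_prob_0)
    fix x :: nat assume x: "0 < x" "x \<le> Suc n"
    have "(\<lambda>j. \<pi> j * s (after_service n x j)) sums s x"
    proof (rule sums_of_suminf_ennreal)
      show "(\<Sum>j. ennreal (\<pi> j * s (after_service n x j))) = ennreal (s x)"
        using services_prob_suminf[OF x(1), of "\<lambda>_. 1" n]
        by (simp add: s ennreal_mult' arrivals_prob_nonneg)
    qed (auto simp: s_def arrivals_prob_nonneg)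
    from sums_diff[OF arrivals_prob_sums this]
    show "(\<lambda>j. \<pi> j * (1 - s (after_service n x j))) sums (1 - s x)"
      by (simp add: right_diff_distrib)
  qed
  then show ?thesis by (simp add: s)
qed

lemma services_prob_mean:
  assumes "x \<le> Suc n"
  shows "(\<Sum>K. of_nat K * services_prob n K x) = ennreal (mean_remaining n x)"
proof -
  define s where "s x = enn2real (\<Sum>K. of_nat K * services_prob n K x)" for x
  have s: "(\<Sum>K. of_nat K * services_prob n K x) = ennreal (s x)" if "x \<le> Suc n" for x
  proof -
    have "(\<Sum>K. of_nat K * services_prob n K x) \<le> ennreal (mean_remaining n x)"
      by (intro suminf_le_const services_prob_partial_bounds that) simp
    then have "(\<Sum>K. of_nat K * services_prob n K x) < top"
      by (rule le_less_trans) simp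
    then show ?thesis by (simp add: s_def)
  qed
  have "mean_remaining n x - s x = 0"
  proof (rule harmonic_unique[where d="\<lambda>x. mean_remaining n x - s x", OF _ _ assms])
    have "(\<Sum>K. of_nat K * services_prob n K 0) = (\<Sum>K\<in>{}. of_nat K * services_prob n K 0)"
      by (rule suminf_finite) (simp_all add: services_prob_empty)
    then show "mean_remaining n 0 - s 0 = 0" by (simp add: s_def mean_remaining_def)
    fix x :: nat assume x: "0 < x" "x \<le> Suc n"
    let ?x = "after_service n x"
    have x': "?x j \<le> Suc n" for j by (simp add: after_service_def)
    have "(\<lambda>j. \<pi> j * (s (?x j) + 1)) sums s x"
    proof (rule sums_of_suminf_ennreal)
      have "(\<Sum>K. of_nat (Suc K) * services_prob n K (?x j)) = ennreal (s (?x j) + 1)" for j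
      proof -
        have "(\<Sum>K. of_nat (Suc K) * services_prob n K (?x j)) =
            (\<Sum>K. of_nat K * services_prob n K (?x j) + services_prob n K (?x j))"
          by (simp add: distrib_right add.commute)
        also have "\<dots> = (\<Sum>K. of_nat K * services_prob n K (?x j)) + (\<Sum>K. services_prob n K (?x j))"
          by (rule suminf_add[symmetric]) auto
        also have "\<dots> = ennreal (s (?x j)) + ennreal 1"
          by (simp only: s[OF x'] services_prob_total[OF x'] ennreal_1)
        also have "\<dots> = ennreal (s (?x j) + 1)"
          by (rule ennreal_plus[symmetric]) (simp_all add: s_def)
        finally show ?thesis .
      qed
      then show "(\<Sum>j. ennreal (\<pi> j * (s (?x j) + 1))) = ennreal (s x)"
        using services_prob_suminf[OF x(1), of of_nat n] x(2)
        by (simp add: s ennreal_mult' arrivals_prob_nonneg)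
    qed (auto simp: s_def arrivals_prob_nonneg)
    from sums_diff[OF sums_add[OF mean_remaining_step[OF x] arrivals_prob_sums] this]
    show "(\<lambda>j. \<pi> j * (mean_remaining n (?x j) - s (?x j))) sums (mean_remaining n x - s x)"
      by (simp add: algebra_simps)
  qed
  then show ?thesis using assms by (simp add: s)
qed

text \<open>
Critical load makes \<open>tail\<close> a probability distribution, with mean \<open>\<sigma> / 2\<close>, to which the renewal
theorem applies.
\<close>
lemma renewal_seq_tail_limit:
  assumes mean: "(\<lambda>j. real j * \<pi> j) sums 1"
    and factorial_moment: "(\<lambda>j. real (j * (j - 1)) / 2 * \<pi> j) sums (\<sigma> / 2)"
  shows "renewal_seq tail \<longlonglongrightarrow> 2 / \<sigma>"
proof -
  have gauss: "(\<Sum>k<j. real k) = real (j * (j - 1)) / 2" for j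
  proof (induction j)
    case (Suc j)
    then show ?case by (cases j) (simp_all add: field_simps)
  qed simp
  have tail_mean: "(\<lambda>k. real k * tail k) sums (\<sigma> / 2)"
    unfolding tail_def
    by (rule weighted_tail_sums[OF arrivals_prob_nonneg arrivals_prob_sums])
       (simp, unfold gauss, rule factorial_moment)
  have tail_total: "tail sums 1"
    using weighted_tail_sums[OF arrivals_prob_nonneg arrivals_prob_sums, of "\<lambda>_. 1" 1] mean
    by (simp add: tail_def[abs_def])
  \<comment> \<open>The tails decrease, so if \<open>tail 1\<close> vanished, the total mass \<open>1\<close> would be \<open>tail 0 < 1\<close>.\<close>
  have tail_1: "0 < tail 1"
  proof (rule ccontr)
    assume "\<not> 0 < tail 1"
    have "tail k = 0" if "k \<notin> {0}" for k
    proof -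
      have "(\<Sum>i\<le>1. \<pi> i) \<le> (\<Sum>i\<le>k. \<pi> i)"
        using that by (intro sum_mono2 arrivals_prob_nonneg) auto
      then have "tail k \<le> tail 1" by (simp add: tail_def)
      then show ?thesis using tail_nonneg[of k] \<open>\<not> 0 < tail 1\<close> by simp
    qed
    then have "tail sums (\<Sum>k\<in>{0}. tail k)"
      by (intro sums_finite) auto
    with tail_total have "1 = (\<Sum>k\<in>{0}. tail k)"
      by (rule sums_unique2)
    then show False
      using tail_0_less_1 by simp
  qed
  have "renewal_seq tail \<longlonglongrightarrow> 1 / (\<sigma> / 2)"
    by (rule renewal_theorem[OF tail_nonneg tail_total tail_1 tail_mean renewal_seq_eq])
       (use tail_0_less_1 in simp)
  then show ?thesis by simp
qed

end

section \<open>From the queueing systems to streams\<close>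

lemma busy_services_unique:
  "busy_services n K x as ss \<Longrightarrow> busy_services n K' x as ss \<Longrightarrow> K = K'"
proof (induction K arbitrary: K' x as ss)
  case 0
  then show ?case by (cases K') auto
next
  case (Suc K)
  then show ?case by (cases K') (auto dest: arrivals_before_unique)
qed

context MGI1
begin

lemma service_law: "service_law B lam"
proof -
  have "prob_space B"
    using prob_space_distr[OF service_rv[of 0]] by (simp add: service_distr)
  moreover have "sets B = sets borel"
    unfolding service_distr[of 0, symmetric] by simp
  ultimately show ?thesis
    by (intro service_law.intro service_law_axioms.intro rate_pos service_nonneg)
qed

text \<open>
The interarrival time \<open>A 0\<close> is left out: it only determines when the busy period begins.
\<close>
definition arrival_stream :: "'a \<Rightarrow> real stream" where
  "arrival_stream \<omega> = to_stream (\<lambda>i. A (Suc i) \<omega>)"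

definition service_stream :: "'a \<Rightarrow> real stream" where
  "service_stream \<omega> = to_stream (\<lambda>k. S k \<omega>)"

lemma interarrival_rv: "random_variable borel (A i)"
  using distributed_measurable[OF interarrival[of i]] by simp

lemma interarrival_distr: "distr M borel (A i) = exponential_measure lam"
proof -
  have "distr M borel (A i) = distr M lborel (A i)"
    by (rule distr_cong) simp_all
  then show ?thesis
    using distributed_distr_eq_density[OF interarrival[of i]] by simp
qed

text \<open>
An injection \<open>f\<close> selects an i.i.d. subfamily: the service times, or the interarrival times after
the first arrival.
\<close>
lemma stream_distr:
  fixes f :: "nat \<Rightarrow> nat + nat"
  assumes "inj f" and N: "\<And>i. distr M borel (case_sum A S (f i)) = N"
  shows "distr M (stream_space borel) (\<lambda>\<omega>. to_stream (\<lambda>i. case_sum A S (f i) \<omega>)) = stream_space N"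
proof -
  let ?X = "case_sum A S"
  have rv: "random_variable borel (?X i)" for i
    by (cases i) (simp_all add: interarrival_rv service_rv)
  let ?D = "\<lambda>i. distr M borel (?X i)"
  have sets_N: "sets N = sets borel" using N[of 0] by auto
  have joint: "distr M (\<Pi>\<^sub>M i\<in>UNIV. borel) (\<lambda>\<omega> i. ?X i \<omega>) = (\<Pi>\<^sub>M i\<in>UNIV. ?D i)"
    using indep indep_vars_iff_distr_eq_PiM[where I=UNIV and M'="\<lambda>_. borel" and X="?X"] rv
    by (simp add: restrict_def)
  have "(\<Pi>\<^sub>M i\<in>UNIV. N) = distr (\<Pi>\<^sub>M i\<in>UNIV. ?D i) (\<Pi>\<^sub>M i\<in>UNIV. N) (\<lambda>\<omega> i. \<omega> (f i))"
    using distr_PiM_reindex[of UNIV ?D f UNIV] \<open>inj f\<close> by (simp add: N prob_space_distr rv restrict_def)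
  also have "\<dots> = distr M (\<Pi>\<^sub>M i\<in>UNIV. N) (\<lambda>\<omega> i. ?X (f i) \<omega>)"
    unfolding joint[symmetric]
    by (subst distr_distr) (auto simp: o_def sets_N cong: measurable_cong_sets sets_PiM_cong intro!: measurable_PiM_single' rv)
  finally have *: "(\<Pi>\<^sub>M i\<in>UNIV. N) = distr M (\<Pi>\<^sub>M i\<in>UNIV. N) (\<lambda>\<omega> i. ?X (f i) \<omega>)" .
  have m: "(\<lambda>\<omega> i. ?X (f i) \<omega>) \<in> M \<rightarrow>\<^sub>M (\<Pi>\<^sub>M i\<in>UNIV. N)"
    by (rule measurable_PiM_single') (auto simp: sets_N sets_eq_imp_space_eq[OF sets_N] rv cong: measurable_cong_sets)
  have "stream_space N = distr (\<Pi>\<^sub>M i\<in>UNIV. N) (stream_space N) to_stream"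
    by (rule stream_space_eq_distr)
  also have "\<dots> = distr M (stream_space N) (to_stream \<circ> (\<lambda>\<omega> i. ?X (f i) \<omega>))"
    by (subst *, rule distr_distr) (use m in simp_all)
  also have "\<dots> = distr M (stream_space borel) (\<lambda>\<omega>. to_stream (\<lambda>i. ?X (f i) \<omega>))"
    by (rule distr_cong) (simp_all add: o_def sets_stream_space_cong[OF sets_N])
  finally show ?thesis ..
qed

lemma joint_stream_distr:
  "distr M (stream_space borel \<Otimes>\<^sub>M stream_space borel) (\<lambda>\<omega>. (service_stream \<omega>, arrival_stream \<omega>)) =
    stream_space B \<Otimes>\<^sub>M stream_space (exponential_measure lam)"
proof -
  let ?I = "range (Inr :: nat \<Rightarrow> nat + nat)" and ?J = "range (Inl :: nat \<Rightarrow> nat + nat)"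
  have "indep_var (PiM ?I (\<lambda>_. borel)) (\<lambda>\<omega>. restrict (\<lambda>i. case_sum A S i \<omega>) ?I)
      (PiM ?J (\<lambda>_. borel)) (\<lambda>\<omega>. restrict (\<lambda>i. case_sum A S i \<omega>) ?J)"
    by (rule indep_var_restrict[OF indep]) auto
  then have "indep_var (stream_space borel) ((\<lambda>x. to_stream (\<lambda>k. x (Inr k))) \<circ> (\<lambda>\<omega>. restrict (\<lambda>i. case_sum A S i \<omega>) ?I))
      (stream_space borel) ((\<lambda>x. to_stream (\<lambda>k. x (Inl (Suc k)))) \<circ> (\<lambda>\<omega>. restrict (\<lambda>i. case_sum A S i \<omega>) ?J))"
    by (rule indep_var_compose)
       (auto intro!: measurable_compose[OF measurable_PiM_single' measurable_to_stream] measurable_component_singleton)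
  then have "indep_var (stream_space borel) service_stream (stream_space borel) arrival_stream"
    by (simp add: o_def service_stream_def[abs_def] arrival_stream_def[abs_def])
  then have "distr M (stream_space borel \<Otimes>\<^sub>M stream_space borel) (\<lambda>\<omega>. (service_stream \<omega>, arrival_stream \<omega>)) =
      distr M (stream_space borel) service_stream \<Otimes>\<^sub>M distr M (stream_space borel) arrival_stream"
    by (simp add: indep_var_distribution_eq)
  also have "distr M (stream_space borel) service_stream = stream_space B"
    using stream_distr[of Inr B] by (simp add: service_stream_def[abs_def] service_distr)
  also have "distr M (stream_space borel) arrival_stream = stream_space (exponential_measure lam)"
    using stream_distr[of "\<lambda>i. Inl (Suc i)" "exponential_measure lam"]
    by (simp add: arrival_stream_def[abs_def] interarrival_distr inj_def)
  finally show ?thesis .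
qed

lemma measurable_streams [measurable]:
  "arrival_stream \<in> M \<rightarrow>\<^sub>M stream_space borel" "service_stream \<in> M \<rightarrow>\<^sub>M stream_space borel"
  unfolding arrival_stream_def service_stream_def
  by (auto intro!: measurable_compose[OF measurable_PiM_single' measurable_to_stream] interarrival_rv service_rv)

lemma emeasure_busy_services:
  "emeasure M {\<omega> \<in> space M. busy_services n K x (arrival_stream \<omega>) (service_stream \<omega>)} =
    service_law.services_prob B lam n K x"
proof -
  interpret L: service_law B lam by (rule service_law)
  interpret SE: prob_space "stream_space (exponential_measure lam)" by (rule L.prob_space_SE)
  let ?N = "stream_space borel \<Otimes>\<^sub>M stream_space borel :: (real stream \<times> real stream) measure"
  let ?f = "\<lambda>(ss, as). indicator {as. busy_services n K x as ss} as :: ennreal"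
  have [measurable]: "?f \<in> borel_measurable ?N" by measurable
  have "emeasure M {\<omega> \<in> space M. busy_services n K x (arrival_stream \<omega>) (service_stream \<omega>)} =
      (\<integral>\<^sup>+\<omega>. ?f (service_stream \<omega>, arrival_stream \<omega>) \<partial>M)"
  proof (subst nn_integral_indicator[symmetric])
    show "{\<omega> \<in> space M. busy_services n K x (arrival_stream \<omega>) (service_stream \<omega>)} \<in> events"
      by measurable
  qed (rule nn_integral_cong, simp add: indicator_def)
  also have "\<dots> = (\<integral>\<^sup>+p. ?f p \<partial>distr M ?N (\<lambda>\<omega>. (service_stream \<omega>, arrival_stream \<omega>)))"
    by (rule nn_integral_distr[symmetric]) measurable
  also have "\<dots> = (\<integral>\<^sup>+ss. \<integral>\<^sup>+as. ?f (ss, as) \<partial>L.SE \<partial>L.SB)"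
    unfolding joint_stream_distr by (rule SE.nn_integral_fst[symmetric]) measurable
  finally show ?thesis by (simp add: L.services_prob_def)
qed

lemma AE_service_nonneg: "AE \<omega> in M. \<forall>k. 0 \<le> S k \<omega>"
  unfolding AE_all_countable
proof
  fix k
  have "AE x in distr M borel (S k). 0 \<le> x"
    unfolding service_distr by (rule service_nonneg)
  then show "AE \<omega> in M. 0 \<le> S k \<omega>"
    by (simp add: AE_distr_iff service_rv)
qed

lemma AE_interarrival_pos: "AE \<omega> in M. \<forall>i. 0 < A i \<omega>"
  unfolding AE_all_countable
proof
  fix i
  have "AE x in exponential_measure lam. 0 < x"
    using AE_lborel_singleton[of 0]
    by (subst AE_density) (auto elim!: eventually_mono simp: exponential_density_def)
  then have "AE x in distr M borel (A i). 0 < x"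
    unfolding interarrival_distr .
  then show "AE \<omega> in M. 0 < A i \<omega>"
    by (simp add: AE_distr_iff interarrival_rv)
qed

lemma AE_processed:
  "AE \<omega> in M. \<forall>K. busy_services n K 1 (arrival_stream \<omega>) (service_stream \<omega>) \<longrightarrow>
    processed n (arrival_time A \<omega>) (\<lambda>k. S k \<omega>) = of_nat K"
  using AE_service_nonneg AE_interarrival_pos
proof eventually_elim
  case (elim \<omega>)
  have "mono (arrival_time A \<omega>)"
    by (rule mono_iff_le_Suc[THEN iffD2]) (use elim in \<open>auto simp: arrival_time_def less_imp_le\<close>)
  moreover have "arrival_time A \<omega> (Suc l) = arrival_time A \<omega> 0 + (\<Sum>m\<le>l. arrival_stream \<omega> !! m)" for l
    by (simp only: arrival_time_def sum.atMost_Suc_shift) (simp add: arrival_stream_def to_stream_def)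
  ultimately show ?case
    using elim by (intro allI impI processed_eq_services)
      (auto simp: arrival_stream_def service_stream_def to_stream_def)
qed

text \<open>
The busy period ends almost surely after some number of services, and this number is the number
of processed messages; its mean has been computed above.
\<close>
theorem expected_processed_eq:
  "expected_processed M A S n =
    ennreal (renewal_sum (service_law.tail B lam) n)"
proof -
  interpret L: service_law B lam by (rule service_law)
  let ?E = "\<lambda>K. {\<omega> \<in> space M. busy_services n K 1 (arrival_stream \<omega>) (service_stream \<omega>)}"
  have E [measurable]: "?E K \<in> events" for K by measurable
  have emeasure_E: "emeasure M (?E K) = L.services_prob n K 1" for K
    by (rule emeasure_busy_services)
  have disj: "disjoint_family ?E"
    unfolding disjoint_family_on_def using busy_services_unique by blast
  have "emeasure M (\<Union>K. ?E K) = (\<Sum>K. emeasure M (?E K))"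
    by (rule suminf_emeasure[symmetric]) (use disj in auto)
  also have "\<dots> = 1"
    unfolding emeasure_E by (rule L.services_prob_total) simp
  finally have "emeasure M (\<Union>K. ?E K) = 1" .
  then have AE_E: "AE \<omega> in M. \<omega> \<in> (\<Union>K. ?E K)"
    by (subst AE_in_set_eq_1) (auto simp: measure_def)
  have "expected_processed M A S n = (\<integral>\<^sup>+\<omega>. (\<Sum>K. of_nat K * indicator (?E K) \<omega>) \<partial>M)"
    unfolding expected_processed_def
  proof (intro nn_integral_cong_AE, use AE_E AE_processed[of n] in eventually_elim)
    case (elim \<omega>)
    then obtain K where K: "\<omega> \<in> ?E K" by blast
    then have "\<omega> \<notin> ?E K'" if "K' \<noteq> K" for K'
      using that busy_services_unique by blast
    then have "(\<Sum>K. of_nat K * indicator (?E K) \<omega>) = (\<Sum>K\<in>{K}. of_nat K * indicator (?E K) \<omega> :: ennreal)"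
      by (intro suminf_finite) auto
    with K elim show ?case by simp
  qed
  also have "\<dots> = (\<Sum>K. of_nat K * emeasure M (?E K))"
    by (simp add: nn_integral_suminf nn_integral_cmult)
  also have "\<dots> = ennreal (L.mean_remaining n 1)"
    unfolding emeasure_E by (rule L.services_prob_mean) simp
  finally show ?thesis by (simp add: L.mean_remaining_def)
qed

lemma rho_eq: "rho lam B j = (\<integral>\<^sup>+x. ennreal ((lam * x) ^ j) \<partial>B)"
proof -
  have "rho lam B j = (\<integral>\<^sup>+x. ennreal (lam ^ j) * (ennreal (x ^ j) * indicator {0..} x) \<partial>B)"
    unfolding rho_def by (rule nn_integral_cmult[symmetric]) (simp add: measurable_cong_sets[OF service_law.sets_B[OF service_law] refl])
  also have "\<dots> = (\<integral>\<^sup>+x. ennreal ((lam * x) ^ j) \<partial>B)"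
    using service_nonneg
    by (intro nn_integral_cong_AE, eventually_elim)
       (use rate_pos in \<open>auto simp: power_mult_distrib ennreal_mult'\<close>)
  finally show ?thesis .
qed

end

section \<open>Growth of the mean at critical load\<close>

theorem theorem4p6:
  fixes M :: "'a measure"
    and A S :: "nat \<Rightarrow> 'a \<Rightarrow> real"
    and lam :: real
    and B :: "real measure"
  assumes "MGI1 M A S lam B"
    and "rho lam B 1 = 1"
    and "rho lam B 2 < \<infinity>"
  shows "(\<forall>n. expected_processed M A S n < \<infinity>) \<and>
    (\<lambda>n. enn2real (expected_processed M A S (n + 1)) - enn2real (expected_processed M A S n)
          - 2 / enn2real (rho lam B 2)) \<in> o(\<lambda>n. 1)"
proof -
  interpret MGI1 M A S lam B by fact
  interpret L: service_law B lam by (rule service_law)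
  define \<sigma> where "\<sigma> = enn2real (rho lam B 2)"
  have mean: "(\<lambda>j. real j * arrivals_prob lam B j) sums 1"
    by (rule L.arrivals_prob_weighted[OF _ poisson_prob_mean]) (use assms(2) rho_eq[of 1] in auto)
  have factorial_moment: "(\<lambda>j. real (j * (j - 1)) / 2 * arrivals_prob lam B j) sums (\<sigma> / 2)"
  proof (rule L.arrivals_prob_weighted[OF _ poisson_prob_factorial_moment])
    have "(\<integral>\<^sup>+x. ennreal ((lam * x)\<^sup>2 / 2) \<partial>B) = rho lam B 2 / 2"
      unfolding rho_eq by (simp add: nn_integral_divide[symmetric] divide_ennreal[symmetric])
    then show "(\<integral>\<^sup>+x. ennreal ((lam * x)\<^sup>2 / 2) \<partial>B) = ennreal (\<sigma> / 2)"
      using assms(3) by (simp add: \<sigma>_def divide_ennreal[symmetric])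
  qed (simp_all add: \<sigma>_def)
  let ?u = "renewal_seq L.tail"
  have "?u \<longlonglongrightarrow> 2 / \<sigma>"
    by (rule L.renewal_seq_tail_limit[OF mean factorial_moment])
  then have "(\<lambda>n. ?u n - 2 / \<sigma>) \<longlonglongrightarrow> 0"
    by (auto intro!: tendsto_eq_intros)
  \<comment> \<open>For \<open>n = 0\<close> the increment is \<open>?u 0 - 1\<close>, as \<open>renewal_sum\<close> starts with \<open>1\<close> instead of \<open>0\<close>.\<close>
  moreover have "eventually (\<lambda>n. ?u n - 2 / \<sigma> = enn2real (expected_processed M A S (n + 1)) -
      enn2real (expected_processed M A S n) - 2 / \<sigma>) sequentially"
    using eventually_gt_at_top[of 0]
  proof eventually_elim
    case (elim n)
    then show ?case
      by (simp add: expected_processed_eq renewal_sum_nonneg L.tail_nonneg L.tail_0_less_1)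
         (simp add: renewal_sum_def)
  qed
  ultimately have "(\<lambda>n. enn2real (expected_processed M A S (n + 1)) -
      enn2real (expected_processed M A S n) - 2 / \<sigma>) \<longlonglongrightarrow> 0"
    by (rule Lim_transform_eventually)
  then show ?thesis
    by (auto simp: expected_processed_eq \<sigma>_def intro!: smalloI_tendsto)
qed

end
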